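(* Let $P\in\mathbb{R}^{n\times n}$ be a consensus matrix with invariant measure $\bm\pi$, let $P^*=\varPi^{-1}P^{\mathsf T}\varPi$ with $\varPi=\operatorname{diag}(\bm\pi)$, and let $\mathcal G(P)$ be the undirected graph associated with $P$. Let $\pi_{\min},\pi_{\max}$ be the minimum and maximum entries of $\bm\pi$, and let $p_{\min}$ be the minimum nonzero entry of $P$. Then $$J(P)\le\frac{\pi_{\max}^3 n}{p_{\min}^2\pi_{\min}^2}\,\bar{\mathcal R}(\mathcal G(P)),\qquad J_{\mathrm w}(P)\le\frac{\pi_{\max}^3n^2}{p_{\min}^2\pi_{\min}}\,\bar{\mathcal R}(\mathcal G(P)).$$ Moreover, if $PP^*=P^*P$, then $$J(P)\ge\frac{\pi_{\min}^3 n}{p_{\max}^2 f(\delta_{\mathrm{in}})\pi_{\max}^2}\,\bar{\mathcal R}(\mathcal G(P)),\qquad J_{\mathrm w}(P)\ge\frac{\pi_{\min}^3n^2}{p_{\max}^2f(\delta_{\mathrm{in}})\pi_{\max}}\,\bar{\mathcal R}(\mathcal G(P)),$$ where $p_{\max}$ is the maximum nonzero entry of $P$, $\delta_{\mathrm{in}}$ is the maximum indegree (excluding self loops) of the directed graph $\mathcal G_{\mathrm{dir}}(P)$ associated with $P$, and $f(\delta_{\mathrm{in}}):=4\delta_{\mathrm{in}}^2+2\delta_{\mathrm{in}}-2$.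
   Context: A consensus matrix is a matrix $P\in\mathbb{R}^{n\times n}$ with nonnegative entries that is row stochastic ($P\bm 1=\bm 1$, where $\bm 1$ is the all-ones vector), irreducible (the directed graph $\mathcal G_{\mathrm{dir}}(P)$ below is strongly connected), and has strictly positive diagonal entries. Its invariant measure $\bm\pi$ is the unique entrywise positive vector with $\bm\pi^{\mathsf T}P=\bm\pi^{\mathsf T}$ and $\sum_u\pi_u=1$. $\mathcal G_{\mathrm{dir}}(P)$ is the directed graph on $V=\{1,\dots,n\}$ with an edge $(u,v)$ (from $u$ to $v$) iff $P_{uv}\ne0$. $\mathcal G(P)$ is the undirected graph on $V$ with an edge $\{u,v\}$ iff $P_{uv}\neq0$ or $P_{vu}\ne0$. The linear quadratic (LQ) cost and its weighted version are $$J(P):=\frac1n\sum_{t\ge 0}\|P^t-\bm 1\bm\pi^{\mathsf T}\|_{\mathrm F}^2,\qquad J_{\mathrm w}(P):=\operatorname{tr}\Big[\sum_{t\ge0}(I-\bm\pi\bm 1^{\mathsf T})(P^{\mathsf T})^t\varPi P^t(I-\bm 1\bm\pi^{\mathsf T})\Big],$$ where $\|\cdot\|_{\mathrm F}$ is the Frobenius norm. For a symmetric, entrywise nonnegative, irreducible matrix $C\in\mathbb{R}^{n\times n}$ (a conductance matrix), $L(C):=\operatorname{diag}(C\bm 1)-C$ and the effective resistance between $a$ and $b$ is $\mathcal R_{ab}(C):=(\bm e_a-\bm e_b)^{\mathsf T}L(C)^\dagger(\bm e_a-\bm e_b)$, with $\dagger$ the Moore–Penrose pseudoinverse. For a connected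 undirected graph $\mathcal G$ on $V$, $\mathcal R_{ab}(\mathcal G)$ denotes the effective resistance when every edge has unit conductance (i.e. $C$ is the 0/1 adjacency matrix of $\mathcal G$; self loops are irrelevant), and $\bar{\mathcal R}(\mathcal G):=\frac1{2n^2}\sum_{u,v\in V}\mathcal R_{uv}(\mathcal G)$ is the average effective resistance. *)

theory Defs
  imports "HOL-Analysis.Analysis"
begin

text \<open>
  Matrices have type \<^typ>\<open>real ^ 'n ^ 'n\<close>, with vertex set \<open>V = UNIV :: 'n set\<close> and
  \<open>n = CARD('n)\<close>. On this type the library's \<open>*\<close>, \<open>^\<close> and \<open>1\<close> are entrywise: the matrix
  product is \<open>**\<close>, the identity matrix is \<open>mat 1\<close>, matrix powers are defined below, and for
  vectors \<open>1 :: real ^ 'n\<close> is the all-ones vector.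
\<close>

primrec mat_power :: "real ^ 'n ^ 'n \<Rightarrow> nat \<Rightarrow> real ^ 'n ^ 'n" where
  "mat_power A 0 = mat 1"
| "mat_power A (Suc t) = A ** mat_power A t"

definition diag :: "real ^ 'n \<Rightarrow> real ^ 'n ^ 'n" where
  "diag x = (\<chi> i j. if i = j then x $ i else 0)"

definition outer :: "real ^ 'n \<Rightarrow> real ^ 'n \<Rightarrow> real ^ 'n ^ 'n" where
  "outer x y = (\<chi> i j. x $ i * y $ j)"

definition frobenius_norm :: "real ^ 'n ^ 'n \<Rightarrow> real" where
  "frobenius_norm A = sqrt (\<Sum>i\<in>UNIV. \<Sum>j\<in>UNIV. (A $ i $ j)\<^sup>2)"

text \<open>The four Penrose conditions determine \<open>X\<close> uniquely, and such an \<open>X\<close> always exists.\<close>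

definition pseudoinverse :: "real ^ 'n ^ 'n \<Rightarrow> real ^ 'n ^ 'n" where
  "pseudoinverse A = (THE X. A ** X ** A = A \<and> X ** A ** X = X \<and>
     transpose (A ** X) = A ** X \<and> transpose (X ** A) = X ** A)"


definition dir_graph :: "real ^ 'n ^ 'n \<Rightarrow> 'n rel" where
  "dir_graph P = {(u, v). P $ u $ v \<noteq> 0}"

text \<open>An undirected graph is given by its edges \<open>{u, v}\<close>; a self loop at \<open>u\<close> is the singleton \<open>{u}\<close>.\<close>

definition undir_graph :: "real ^ 'n ^ 'n \<Rightarrow> 'n set set" where
  "undir_graph P = {{u, v} |u v. P $ u $ v \<noteq> 0 \<or> P $ v $ u \<noteq> 0}"

definition strongly_connected :: "'n rel \<Rightarrow> bool" where
  "strongly_connected E \<longleftrightarrow> (\<forall>u v. (u, v) \<in> E\<^sup>*)"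

definition max_in_degree :: "('n::finite) rel \<Rightarrow> nat" where
  "max_in_degree E = Max (range (\<lambda>v. card {u. u \<noteq> v \<and> (u, v) \<in> E}))"

definition adjacency :: "('n::finite) set set \<Rightarrow> real ^ 'n ^ 'n" where
  "adjacency E = (\<chi> u v. if {u, v} \<in> E then 1 else 0)"


definition consensus_matrix :: "real ^ 'n ^ 'n \<Rightarrow> bool" where
  "consensus_matrix P \<longleftrightarrow>
     (\<forall>u v. P $ u $ v \<ge> 0) \<and>
     P *v 1 = 1 \<and>
     strongly_connected (dir_graph P) \<and>
     (\<forall>u. P $ u $ u > 0)"

text \<open>For a consensus matrix, existence and uniqueness are the Perron--Frobenius theorem.\<close>

definition invariant_measure :: "real ^ 'n ^ 'n \<Rightarrow> real ^ 'n" where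
  "invariant_measure P =
     (THE \<pi>. (\<forall>u. \<pi> $ u > 0) \<and> \<pi> v* P = \<pi> \<and> (\<Sum>u\<in>UNIV. \<pi> $ u) = 1)"

definition time_reversal :: "real ^ 'n ^ 'n \<Rightarrow> real ^ 'n ^ 'n" where
  "time_reversal P =
     (let D = diag (invariant_measure P) in matrix_inv D ** transpose P ** D)"


text \<open>Both series converge for every consensus matrix, since \<open>P\<^sup>t\<close> then converges to
  \<open>1\<pi>\<^sup>T\<close> geometrically. The second one is a series of matrices.\<close>

definition LQ_cost :: "real ^ 'n ^ 'n \<Rightarrow> real" where
  "LQ_cost P =
     1 / real CARD('n) *
       (\<Sum>t. (frobenius_norm (mat_power P t - outer 1 (invariant_measure P)))\<^sup>2)"

definition weighted_LQ_cost :: "real ^ 'n ^ 'n \<Rightarrow> real" where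
  "weighted_LQ_cost P =
     (let \<pi> = invariant_measure P in
      trace (\<Sum>t. (mat 1 - outer \<pi> 1) ** mat_power (transpose P) t ** diag \<pi>
                   ** mat_power P t ** (mat 1 - outer 1 \<pi>)))"


definition laplacian :: "real ^ 'n ^ 'n \<Rightarrow> real ^ 'n ^ 'n" where
  "laplacian C = diag (C *v 1) - C"

definition eff_resistance :: "real ^ 'n ^ 'n \<Rightarrow> 'n \<Rightarrow> 'n \<Rightarrow> real" where
  "eff_resistance C a b =
     (axis a 1 - axis b 1) \<bullet> (pseudoinverse (laplacian C) *v (axis a 1 - axis b 1))"

definition avg_eff_resistance :: "('n::finite) set set \<Rightarrow> real" where
  "avg_eff_resistance E =
     1 / (2 * (real CARD('n))\<^sup>2) * (\<Sum>u\<in>UNIV. \<Sum>v\<in>UNIV. eff_resistance (adjacency E) u v)"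


definition min_entry :: "real ^ 'n \<Rightarrow> real" where
  "min_entry x = Min (range (\<lambda>u. x $ u))"

definition max_entry :: "real ^ 'n \<Rightarrow> real" where
  "max_entry x = Max (range (\<lambda>u. x $ u))"

definition min_nonzero_entry :: "real ^ 'n ^ 'n \<Rightarrow> real" where
  "min_nonzero_entry P = Min {P $ u $ v |u v. P $ u $ v \<noteq> 0}"

definition max_nonzero_entry :: "real ^ 'n ^ 'n \<Rightarrow> real" where
  "max_nonzero_entry P = Max {P $ u $ v |u v. P $ u $ v \<noteq> 0}"

text \<open>Real-valued: over \<^typ>\<open>nat\<close> the subtraction would truncate at \<open>\<delta> = 0\<close>.\<close>

definition f_in :: "nat \<Rightarrow> real" where
  "f_in \<delta> = 4 * (real \<delta>)\<^sup>2 + 2 * real \<delta> - 2"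

end

theory Submission
  imports Defs
begin

text \<open>
  The space of functions on \<open>V\<close> carries the inner product weighted by
  \<open>\<pi>\<close>, in which the time reversal \<open>P\<^sup>*\<close> is the adjoint of
  \<open>P\<close>. In an orthonormal basis of it, \<open>P\<close> is a matrix \<open>A\<close>
  that fixes, from both sides, the unit vector \<open>s\<close> with entries
  \<open>\<surd>\<pi>\<^sub>u\<close>. Up to a factor between \<open>\<pi>_min\<close> and
  \<open>\<pi>_max\<close>, the \<open>t\<close>-th term of the weighted cost is
  \<open>\<parallel>A\<^sup>t - ss\<^sup>T\<parallel>\<^sup>2 = tr(A\<^sup>t (A\<^sup>t)\<^sup>T) - 1\<close>,
  and the cost itself differs from the weighted one, after division by \<open>n\<close>, by
  factors of the same kind. So only \<open>J\<^sub>w\<close> matters.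

  For every matrix,
  \<open>tr(A\<^sup>t (A\<^sup>t)\<^sup>T) \<le> tr((A\<^sup>T A)\<^sup>t)\<close> (lemma
  \<open>trace_power_le\<close>, a reflection argument on words in \<open>A\<close> and
  \<open>A\<^sup>T\<close>), with equality if \<open>A\<close> is normal. Thus \<open>A\<close>
  can be replaced by the symmetric matrix \<open>K = A\<^sup>T A\<close>, for which the series is
  geometric: \<open>\<Sum>\<^sub>t (tr K\<^sup>t - 1)\<close> is the trace of the inverse of
  \<open>I - K\<close> on the complement of \<open>s\<close> (lemma
  \<open>trace_power_sums\<close>). This also proves that both cost series converge.

  The form of \<open>I - K\<close> is the energy of a resistor network on \<open>V\<close> with
  conductances
  \<open>c\<^sub>u\<^sub>v = \<Sum>\<^sub>w \<pi>\<^sub>w P\<^sub>w\<^sub>u P\<^sub>w\<^sub>v\<close>,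
  while the average effective resistance of the graph is, up to a factor \<open>n\<close>, the
  trace of the inverse of its unit-conductance Laplacian (lemma
  \<open>avg_eff_resistance_green\<close>). Inverting positive forms reverses their order (lemma
  \<open>green_trace_mono\<close>), so it suffices to compare the two energies. Self loops give
  \<open>c\<^sub>u\<^sub>v \<ge> \<pi>_min p_min\<^sup>2\<close> on edges of the graph (lemma
  \<open>energy_ge\<close>). Conversely, if \<open>P\<close> is normal, two vertices with
  \<open>c\<^sub>u\<^sub>v > 0\<close> have a common out-neighbour, through which their difference
  is controlled; counting how often each edge is used gives \<open>f_in\<close> (lemma
  \<open>energy_le\<close>).
\<close>

section \<open>Traces of words in a matrix and its transpose\<close>

lemma trace_mult_transpose:
  fixes X :: "real ^ 'n ^ 'n"
  shows "trace (X ** transpose X) = (\<Sum>i\<in>UNIV. \<Sum>j\<in>UNIV. (X $ i $ j)\<^sup>2)"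
  by (simp add: trace_def matrix_matrix_mult_def transpose_def power2_eq_square)

lemma trace_mult_transpose_nonneg:
  fixes X :: "real ^ 'n ^ 'n"
  shows "0 \<le> trace (X ** transpose X)"
  unfolding trace_mult_transpose by (intro sum_nonneg) simp

lemma trace_Cauchy_Schwarz:
  fixes X Y :: "real ^ 'n ^ 'n"
  shows "(trace (X ** Y))\<^sup>2 \<le> trace (X ** transpose X) * trace (Y ** transpose Y)"
proof -
  have "(trace (X ** Y))\<^sup>2 = (\<Sum>(i,j)\<in>UNIV. X $ i $ j * Y $ j $ i)\<^sup>2"
    by (simp add: trace_def matrix_matrix_mult_def sum.cartesian_product)
  also have "\<dots> = (\<Sum>p\<in>UNIV. X $ fst p $ snd p * Y $ snd p $ fst p)\<^sup>2"
    by (simp add: case_prod_beta)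
  also have "\<dots> \<le> (\<Sum>p\<in>UNIV. (X $ fst p $ snd p)\<^sup>2) * (\<Sum>p\<in>UNIV. (Y $ snd p $ fst p)\<^sup>2)"
    by (rule Cauchy_Schwarz_ineq_sum)
  also have "(\<Sum>p\<in>UNIV. (X $ fst p $ snd p)\<^sup>2) = trace (X ** transpose X)"
    by (simp add: trace_mult_transpose sum.cartesian_product case_prod_beta)
  also have "(\<Sum>p\<in>UNIV. (Y $ snd p $ fst p)\<^sup>2) = trace (Y ** transpose Y)"
    unfolding trace_mult_transpose
    by (subst sum.swap) (simp add: sum.cartesian_product case_prod_beta)
  finally show ?thesis .
qed

text \<open>
  A list of Booleans stands for a noncommutative word in a matrix and its transpose:
  \<open>True\<close> is the letter \<open>A\<close> and \<open>False\<close> the letter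
  \<open>A\<^sup>T\<close>.
\<close>

primrec word_product :: "real ^ 'n ^ 'n \<Rightarrow> bool list \<Rightarrow> real ^ 'n ^ 'n" where
  "word_product A [] = mat 1"
| "word_product A (b # w) = (if b then A else transpose A) ** word_product A w"

primrec alternating :: "bool \<Rightarrow> nat \<Rightarrow> bool list" where
  "alternating b 0 = []"
| "alternating b (Suc n) = b # alternating (\<not> b) n"

definition adjoint_word :: "bool list \<Rightarrow> bool list" where
  "adjoint_word w = rev (map Not w)"

lemma word_product_append: "word_product A (v @ w) = word_product A v ** word_product A w"
  by (induction v) (simp_all add: matrix_mul_assoc)

lemma transpose_word_product: "transpose (word_product A w) = word_product A (adjoint_word w)"
  by (induction w)
    (simp_all add: adjoint_word_def word_product_append matrix_transpose_mul)

lemma trace_word_rotate: "trace (word_product A (v @ w)) = trace (word_product A (w @ v))"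
  unfolding word_product_append by (rule trace_mul_sym)

lemma length_alternating [simp]: "length (alternating b n) = n"
  by (induction n arbitrary: b) auto

lemma length_adjoint_word [simp]: "length (adjoint_word w) = length w"
  by (simp add: adjoint_word_def)

lemma alternating_add: "\<exists>c. alternating b (m + n) = alternating b m @ alternating c n"
  by (induction m arbitrary: b) auto

lemma alternating_snoc:
  "alternating b (Suc n) = alternating b n @ [if even n then b else \<not> b]"
proof (induction n arbitrary: b)
  case (Suc n)
  have "alternating b (Suc (Suc n)) = b # alternating (\<not> b) (Suc n)" by simp
  also have "\<dots> = alternating b (Suc n) @ [if even (Suc n) then b else \<not> b]"
    by (subst Suc) simp
  finally show ?case .
qed simp

text \<open>
  This is what makes reflection useful: an alternating block that ends at the mirror continues
  alternating behind it, so its length doubles.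
\<close>

lemma alternating_reflect:
  "alternating b n @ adjoint_word (alternating b n) = alternating b (2 * n)"
proof (induction n arbitrary: b)
  case (Suc n)
  have "alternating b (2 * Suc n) = b # alternating (\<not> b) (2 * n) @ [\<not> b]"
    using alternating_snoc[of "\<not> b" "2 * n"] by simp
  then show ?case using Suc[of "\<not> b"] by (simp add: adjoint_word_def)
qed (simp add: adjoint_word_def)

lemma mat_power_Suc_right: "mat_power A (Suc t) = mat_power A t ** A"
proof (induction t)
  case (Suc t)
  then show ?case by (simp add: matrix_mul_assoc)
qed simp

lemma mat_power_shift:
  fixes A B :: "real ^ 'n ^ 'n"
  shows "mat_power (A ** B) t ** A = A ** mat_power (B ** A) t"
  by (induction t) (simp_all add: matrix_mul_assoc[symmetric])

lemma word_product_alternating: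
  "word_product A (alternating True (2 * t)) = mat_power (A ** transpose A) t"
  "word_product A (alternating False (2 * t)) = mat_power (transpose A ** A) t"
  by (induction t) (simp_all add: matrix_mul_assoc)

lemma trace_mat_power_swap:
  fixes A B :: "real ^ 'n ^ 'n"
  shows "trace (mat_power (A ** B) t) = trace (mat_power (B ** A) t)"
proof (cases t)
  case (Suc n)
  have "trace (mat_power (A ** B) (Suc n)) = trace ((mat_power (A ** B) n ** A) ** B)"
    by (simp only: mat_power_Suc_right matrix_mul_assoc)
  also have "\<dots> = trace (B ** A ** mat_power (B ** A) n)"
    unfolding mat_power_shift by (subst trace_mul_sym) (simp only: matrix_mul_assoc)
  finally show ?thesis using Suc by simp
qed simp

text \<open>
  Among all words of length \<open>2 t\<close> in \<open>A\<close> and \<open>A\<^sup>T\<close>,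
  the alternating one has the largest trace. This is a chessboard estimate. Cut a maximizing word
  into halves \<open>u\<close>, \<open>v\<close>. By Cauchy--Schwarz,
  \<open>tr(uv)\<^sup>2 \<le> tr(uu\<^sup>T) tr(vv\<^sup>T)\<close>, and since both factors are
  traces of words of length \<open>2 t\<close>, both reflected words are again maximizers. If
  \<open>v\<close> ends in an alternating block (of length at most \<open>t\<close>), the
  reflected word \<open>vv\<^sup>T\<close> contains a block of twice that length, which a cyclic
  rotation moves back to the end. Repeating this yields a maximizer that alternates throughout.
\<close>

lemma trace_word_le:
  assumes "length w = 2 * t"
  shows "trace (word_product A w) \<le> trace (mat_power (transpose A ** A) t)"
proof (cases "t = 0")
  case False
  define W where "W = {w :: bool list. length w = 2 * t}"
  define M where "M = Max ((\<lambda>w. trace (word_product A w)) ` W)"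
  have fin: "finite W"
    using finite_lists_length_eq[of "UNIV :: bool set" "2 * t"] by (simp add: W_def)
  have le: "trace (word_product A w) \<le> M" if "length w = 2 * t" for w
    using fin that by (auto simp: M_def W_def)
  have "W \<noteq> {}" using assms by (auto simp: W_def)
  then have "M \<in> (\<lambda>w. trace (word_product A w)) ` W"
    unfolding M_def by (intro Max_in) (use fin in auto)
  then obtain w0 where w0: "length w0 = 2 * t" "trace (word_product A w0) = M"
    by (auto simp: W_def)
  have reflect: "trace (word_product A (v @ adjoint_word v)) = M"
    if "length u = t" "length v = t" "trace (word_product A (u @ v)) = M" for u v
  proof -
    let ?r = "\<lambda>v. trace (word_product A (v @ adjoint_word v))"
    have nn: "0 \<le> ?r v" for v
      by (simp add: word_product_append trace_mult_transpose_nonneg flip: transpose_word_product)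
    have "M\<^sup>2 \<le> ?r u * ?r v"
      using trace_Cauchy_Schwarz[of "word_product A u" "word_product A v"] that(3)
      by (simp add: word_product_append transpose_word_product)
    also have "\<dots> \<le> M * ?r v"
      by (intro mult_right_mono le nn) (simp add: that)
    finally have "M * M \<le> M * ?r v" by (simp add: power2_eq_square)
    moreover have "?r v \<le> M" by (rule le) (simp add: that)
    ultimately show ?thesis using nn[of v]
      by (cases "M = 0") (auto simp: mult_le_cancel_left)
  qed
  \<comment> \<open>\<open>Q r\<close>: some maximizing word ends in an alternating block of length \<open>r\<close>.\<close>
  define Q where "Q r \<longleftrightarrow> (\<exists>p b. length p + r = 2 * t \<and>
      trace (word_product A (p @ alternating b r)) = M)" for r
  have shrink: "Q r'" if "Q r" "r' \<le> r" for r r'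
  proof -
    obtain p b where p: "length p + r = 2 * t" "trace (word_product A (p @ alternating b r)) = M"
      using \<open>Q r\<close> by (auto simp: Q_def)
    obtain c where "alternating b (r - r' + r') = alternating b (r - r') @ alternating c r'"
      using alternating_add by blast
    then have "trace (word_product A ((p @ alternating b (r - r')) @ alternating c r')) = M"
      using p that by simp
    then show ?thesis unfolding Q_def using p that
      by (intro exI[of _ "p @ alternating b (r - r')"] exI[of _ c]) simp
  qed
  have double: "Q (2 * r)" if "Q r" "r \<le> t" for r
  proof -
    obtain p b where p: "length p + r = 2 * t" "trace (word_product A (p @ alternating b r)) = M"
      using \<open>Q r\<close> by (auto simp: Q_def)
    define v where "v = drop t p @ alternating b r"
    have "take t p @ v = p @ alternating b r"
      unfolding v_def append_assoc[symmetric] by simp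
    with p(2) have "trace (word_product A (take t p @ v)) = M" by simp
    then have "trace (word_product A (v @ adjoint_word v)) = M"
      using p that by (intro reflect[of "take t p" v]) (simp_all add: v_def)
    moreover have "v @ adjoint_word v =
        drop t p @ alternating b (2 * r) @ adjoint_word (drop t p)"
      by (simp add: v_def adjoint_word_def flip: alternating_reflect)
    ultimately have "trace (word_product A (adjoint_word (drop t p) @ drop t p @ alternating b (2 * r))) = M"
      using trace_word_rotate[of A "drop t p @ alternating b (2 * r)" "adjoint_word (drop t p)"]
      by simp
    then show ?thesis unfolding Q_def using p that
      by (intro exI[of _ "adjoint_word (drop t p) @ drop t p"] exI[of _ b]) auto
  qed
  have "Q (Suc r)" if "Suc r \<le> 2 * t" for r
    using that
  proof (induction r)
    case 0
    have "w0 = butlast w0 @ alternating (last w0) (Suc 0)"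
      using w0(1) False by (cases w0 rule: rev_cases) auto
    then show ?case unfolding Q_def using w0 False
      by (intro exI[of _ "butlast w0"] exI[of _ "last w0"]) auto
  next
    case (Suc r)
    show ?case
    proof (cases "Suc r \<le> t")
      case True
      then show ?thesis using Suc double[of "Suc r"] shrink[of "2 * Suc r" "Suc (Suc r)"] by auto
    next
      case False
      then show ?thesis
        using Suc double[of t] shrink[of "Suc r" t] shrink[of "2 * t" "Suc (Suc r)"] by auto
    qed
  qed
  from this[of "2 * t - 1"] have "Q (2 * t)" using False by simp
  then obtain b where "trace (word_product A (alternating b (2 * t))) = M"
    by (auto simp: Q_def)
  then have "M = trace (mat_power (transpose A ** A) t)"
    by (cases b) (auto simp: word_product_alternating trace_mat_power_swap)
  then show ?thesis using le[OF assms] by simp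
qed (use assms in simp)

lemma word_product_replicate:
  "word_product A (replicate t True) = mat_power A t"
  "word_product A (replicate t False) = mat_power (transpose A) t"
  by (induction t) auto

lemma transpose_mat_power: "transpose (mat_power A t) = mat_power (transpose A) t"
proof (induction t)
  case (Suc t)
  have "transpose (mat_power A (Suc t)) = mat_power (transpose A) t ** transpose A"
    by (simp add: matrix_transpose_mul Suc)
  then show ?case by (simp only: mat_power_Suc_right)
qed simp

text \<open>
  The energy \<open>tr(A\<^sup>t (A\<^sup>t)\<^sup>T)\<close> is governed by the symmetric matrix
  \<open>A\<^sup>T A\<close> for an arbitrary, possibly not normal, \<open>A\<close>; usually this
  is deduced from Horn's inequalities for singular values.
\<close>

lemma trace_power_le:
  "trace (mat_power A t ** transpose (mat_power A t)) \<le> trace (mat_power (transpose A ** A) t)"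
  using trace_word_le[of "replicate t True @ replicate t False" t A]
  by (simp add: word_product_append word_product_replicate transpose_mat_power)

lemma mat_power_commute:
  assumes "A ** B = B ** A" shows "mat_power A t ** B = B ** mat_power A t"
proof (induction t)
  case (Suc t)
  have "mat_power A (Suc t) ** B = A ** (mat_power A t ** B)" by (simp add: matrix_mul_assoc)
  also have "\<dots> = (A ** B) ** mat_power A t" by (simp add: Suc matrix_mul_assoc)
  finally show ?case by (simp add: assms matrix_mul_assoc)
qed simp

lemma mat_power_mult:
  assumes "A ** B = B ** A"
  shows "mat_power (A ** B) t = mat_power A t ** mat_power B t"
proof (induction t)
  case (Suc t)
  have "mat_power (A ** B) (Suc t) = A ** (B ** mat_power A t) ** mat_power B t"
    by (simp add: Suc matrix_mul_assoc)
  also have "B ** mat_power A t = mat_power A t ** B" by (rule mat_power_commute[OF assms, symmetric])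
  finally show ?case by (simp add: matrix_mul_assoc)
qed simp

lemma trace_power_normal:
  assumes "A ** transpose A = transpose A ** A"
  shows "trace (mat_power A t ** transpose (mat_power A t)) = trace (mat_power (transpose A ** A) t)"
  using mat_power_mult[OF assms] by (simp add: transpose_mat_power assms)

section \<open>Inverses of positive semidefinite matrices with one-dimensional kernel\<close>

lemma outer_vector: "outer x y *v w = (y \<bullet> w) *\<^sub>R x"
  by (simp add: vec_eq_iff outer_def matrix_vector_mult_def inner_vec_def sum_distrib_left mult_ac)

lemma diag_vector: "diag d *v f = (\<chi> u. d $ u * f $ u)"
  by (simp add: vec_eq_iff diag_def matrix_vector_mult_def if_distrib[of "\<lambda>x. x * _"] cong: if_cong)

lemma symmetric_inner:
  fixes A :: "real ^ 'n ^ 'n"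
  assumes "transpose A = A"
  shows "(A *v x) \<bullet> y = x \<bullet> (A *v y)"
  by (metis assms dot_lmul_matrix transpose_matrix_vector)

lemma transpose_outer: "transpose (outer z z) = outer z z"
  by (simp add: vec_eq_iff outer_def transpose_def mult.commute)

lemma diag_entry_inner: "(A :: real ^ 'n ^ 'n) $ u $ v = axis u 1 \<bullet> (A *v axis v 1)"
  by (simp add: matrix_vector_mul_component inner_axis' inner_axis)

text \<open>
  \<open>G\<close> inverts the positive semidefinite matrix \<open>M\<close> on the complement of
  its kernel, the line through the unit vector \<open>z\<close>. It is the pseudoinverse of
  \<open>M\<close>, characterized by the identities that the trace and energy estimates use;
  \<open>M\<close> will be a graph Laplacian or \<open>I - A\<^sup>T A\<close>.
\<close>

definition is_green :: "real ^ 'n ^ 'n \<Rightarrow> real ^ 'n \<Rightarrow> real ^ 'n ^ 'n \<Rightarrow> bool" where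
  "is_green M z G \<longleftrightarrow>
     transpose M = M \<and> (\<forall>x. 0 \<le> x \<bullet> (M *v x)) \<and> M *v z = 0 \<and> norm z = 1 \<and>
     transpose G = G \<and> G *v z = 0 \<and> M ** G = mat 1 - outer z z"

text \<open>
  Adding the projection \<open>zz\<^sup>T\<close> makes \<open>M\<close> invertible without
  changing it on the complement of \<open>z\<close>; subtracting the projection from the inverse
  gives \<open>G\<close>.
\<close>

lemma green_exists:
  fixes M :: "real ^ 'n ^ 'n"
  assumes sym: "transpose M = M" and psd: "\<And>x. 0 \<le> x \<bullet> (M *v x)"
    and z: "M *v z = 0" "norm z = 1"
    and ker: "\<And>x. x \<bullet> (M *v x) = 0 \<Longrightarrow> \<exists>c. x = c *\<^sub>R z"
  obtains G where "is_green M z G"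
proof -
  have zz: "z \<bullet> z = 1" using z(2) by (simp add: norm_eq_1)
  define N where "N = M + outer z z"
  have Nv: "N *v x = M *v x + (z \<bullet> x) *\<^sub>R z" for x
    by (simp add: N_def matrix_vector_mult_add_rdistrib outer_vector)
  have "x = 0" if "N *v x = 0" for x
  proof -
    have "0 = x \<bullet> (N *v x)" using that by simp
    also have "\<dots> = x \<bullet> (M *v x) + (z \<bullet> x)\<^sup>2"
      by (simp add: Nv inner_add_right power2_eq_square inner_commute)
    finally have "x \<bullet> (M *v x) = 0" "z \<bullet> x = 0"
      using psd[of x] by (auto simp: add_nonneg_eq_0_iff)
    then show ?thesis using ker[of x] zz by auto
  qed
  then obtain B where "B ** N = mat 1"
    using matrix_left_invertible_ker[of N] by auto
  then have NB: "N ** B = mat 1" and BN: "B ** N = mat 1"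
    by (auto simp: matrix_left_right_inverse)
  have symN: "transpose N = N" 
    using sym transpose_outer[of z] by (simp add: N_def vec_eq_iff transpose_def)
  have symB: "transpose B = B"
  proof -
    have "transpose B ** N = mat 1"
      using NB symN by (metis matrix_transpose_mul transpose_mat)
    then show ?thesis by (metis NB matrix_mul_assoc matrix_mul_lid matrix_mul_rid)
  qed
  have Bz: "B *v z = z"
  proof -
    have "N *v z = z" by (simp add: Nv z zz)
    then have "B *v z = (B ** N) *v z" by (simp add: matrix_vector_mul_assoc[symmetric])
    then show ?thesis by (simp add: BN)
  qed
  define G where "G = B - outer z z"
  have "M ** G = mat 1 - outer z z"
  proof -
    have "(M ** G) *v x = (mat 1 - outer z z) *v x" for x
    proof -
      have "(M ** G) *v x = M *v (B *v x)"
        by (simp add: G_def matrix_vector_mul_assoc[symmetric] matrix_vector_mult_diff_rdistrib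
            matrix_vector_mult_diff_distrib outer_vector matrix_vector_mult_scaleR z)
      also have "\<dots> = N *v (B *v x) - (z \<bullet> (B *v x)) *\<^sub>R z" by (simp add: Nv)
      also have "N *v (B *v x) = x" by (simp add: matrix_vector_mul_assoc NB)
      also have "z \<bullet> (B *v x) = z \<bullet> x" using symmetric_inner[OF symB, of z x] Bz by simp
      finally show ?thesis by (simp add: matrix_vector_mult_diff_rdistrib outer_vector)
    qed
    then show ?thesis by (simp add: matrix_eq)
  qed
  moreover have "transpose G = G"
    using symB transpose_outer[of z] by (simp add: G_def vec_eq_iff transpose_def)
  moreover have "G *v z = 0"
    by (simp add: G_def matrix_vector_mult_diff_rdistrib outer_vector Bz zz)
  ultimately show ?thesis using that assms by (auto simp: is_green_def)
qed

lemma green_commute: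
  assumes "is_green M z G" shows "G ** M = mat 1 - outer z z"
proof -
  have "G ** M = transpose (M ** G)"
    using assms unfolding is_green_def by (metis matrix_transpose_mul)
  also have "\<dots> = mat 1 - outer z z"
    using assms transpose_outer[of z] by (simp add: is_green_def vec_eq_iff transpose_def mat_def)
  finally show ?thesis .
qed

lemma green_solves:
  assumes "is_green M z G" "z \<bullet> y = 0" shows "M *v (G *v y) = y"
  using assms by (simp add: is_green_def matrix_vector_mul_assoc matrix_vector_mult_diff_rdistrib outer_vector)

lemma green_orthogonal:
  assumes "is_green M z G" shows "z \<bullet> (G *v y) = 0"
  using assms symmetric_inner[of G z y] by (simp add: is_green_def)

lemma green_psd:
  assumes "is_green M z G" shows "0 \<le> y \<bullet> (G *v y)"
proof -
  have "M *v (G *v y) = y - (z \<bullet> y) *\<^sub>R z"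
    using assms by (simp add: is_green_def matrix_vector_mul_assoc matrix_vector_mult_diff_rdistrib outer_vector)
  then have "(G *v y) \<bullet> (M *v (G *v y)) = y \<bullet> (G *v y)"
    using green_orthogonal[OF assms, of y]
    by (simp add: inner_diff_right inner_commute)
  then show ?thesis using assms by (metis is_green_def)
qed

text \<open>
  \<open>AX\<close> and \<open>AY\<close> are orthogonal projections onto the same range,
  \<open>XA\<close> and \<open>YA\<close> onto the same corange; hence
  \<open>X = XAX = XAY = YAY = Y\<close>.
\<close>

lemma Penrose_unique:
  fixes A X Y :: "real ^ 'n ^ 'n"
  assumes X: "A ** X ** A = A" "X ** A ** X = X" "transpose (A ** X) = A ** X" "transpose (X ** A) = X ** A"
    and Y: "A ** Y ** A = A" "Y ** A ** Y = Y" "transpose (A ** Y) = A ** Y" "transpose (Y ** A) = Y ** A"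
  shows "X = Y"
proof -
  have "A ** X = (A ** Y) ** (A ** X)" using Y(1) by (metis matrix_mul_assoc)
  also have "\<dots> = transpose ((A ** X) ** (A ** Y))"
    by (simp only: matrix_transpose_mul[of "A ** X" "A ** Y"] X Y)
  also have "(A ** X) ** (A ** Y) = A ** Y" using X(1) by (metis matrix_mul_assoc)
  finally have 1: "A ** X = A ** Y" using Y by simp
  have "X ** A = (X ** A) ** (Y ** A)" using Y(1) by (metis matrix_mul_assoc)
  also have "\<dots> = transpose ((Y ** A) ** (X ** A))"
    by (simp only: matrix_transpose_mul[of "Y ** A" "X ** A"] X Y)
  also have "(Y ** A) ** (X ** A) = Y ** A" using X(1) by (metis matrix_mul_assoc)
  finally have 2: "X ** A = Y ** A" using Y by simp
  show ?thesis by (metis 1 2 X(2) Y(2) matrix_mul_assoc)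
qed

lemma pseudoinverse_green:
  assumes "is_green M z G" shows "pseudoinverse M = G"
proof -
  let ?Q = "mat 1 - outer z z"
  have MG: "M ** G = ?Q" and GM: "G ** M = ?Q"
    using assms green_commute by (auto simp: is_green_def)
  have Q: "transpose ?Q = ?Q"
    using transpose_outer[of z] by (simp add: vec_eq_iff transpose_def mat_def)
  have "M ** G ** M = M" "G ** M ** G = G"
    using MG GM assms
    by (auto simp: matrix_eq matrix_mul_assoc[symmetric] matrix_vector_mul_assoc[symmetric]
        matrix_vector_mult_diff_distrib matrix_vector_mult_diff_rdistrib outer_vector
        matrix_vector_mult_scaleR is_green_def)
  then have P: "M ** G ** M = M \<and> G ** M ** G = G \<and> transpose (M ** G) = M ** G \<and>
      transpose (G ** M) = G ** M"
    by (simp add: MG GM Q)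
  show ?thesis unfolding pseudoinverse_def
    by (rule the_equality) (use P in blast, metis P Penrose_unique)
qed

text \<open>
  Inversion reverses the order of quadratic forms, here across a diagonal change of variables. For
  \<open>y\<close> orthogonal to \<open>z1\<close> and \<open>x = G1 y\<close>, the value
  \<open>y \<bullet> G1 y = 2 y \<bullet> x - x \<bullet> M1 x\<close> grows if \<open>M1\<close>
  is replaced by a smaller form, and completing the square then bounds it by the value of
  \<open>G2\<close>. Summing over the projections of the unit vectors gives the traces; the
  condition on \<open>diag d *v z2\<close> makes the change of variables respect the complements
  of the two kernels.
\<close>

lemma green_trace_mono:
  fixes d :: "real ^ 'n"
  assumes g1: "is_green M1 z1 G1" and g2: "is_green M2 z2 G2"
    and d: "\<And>u. d $ u \<noteq> 0" and m: "\<And>u. (d $ u)\<^sup>2 \<le> m"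
    and dz: "diag d *v z2 = a *\<^sub>R z1" and \<kappa>: "\<kappa> > 0"
    and le: "\<And>f. \<kappa> * (f \<bullet> (M2 *v f)) \<le> (diag d *v f) \<bullet> (M1 *v (diag d *v f))"
  shows "\<kappa> * trace G1 \<le> m * trace G2"
proof -
  let ?S = "\<lambda>f. diag d *v f"
  have Sadj: "?S x \<bullet> y = x \<bullet> ?S y" for x y
    by (simp add: diag_vector inner_vec_def mult_ac)
  have zz: "z1 \<bullet> z1 = 1" using g1 by (simp add: is_green_def norm_eq_1)
  have symG2: "transpose G2 = G2" and symM2: "transpose M2 = M2" using g2 by (auto simp: is_green_def)
  define h where "h = ?S z1"
  define y where "y v = axis v 1 - z1 $ v *\<^sub>R z1" for v
  have main: "\<kappa> * G1 $ v $ v \<le> ?S (y v) \<bullet> (G2 *v ?S (y v))" for v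
  proof -
    have y: "z1 \<bullet> y v = 0"
      by (simp add: y_def inner_diff_right zz inner_axis)
    define x where "x = G1 *v y v"
    have M1x: "M1 *v x = y v" unfolding x_def by (rule green_solves[OF g1 y])
    have "G1 *v y v = G1 *v axis v 1"
      using g1 by (simp add: y_def matrix_vector_mult_diff_distrib matrix_vector_mult_scaleR is_green_def)
    then have "y v \<bullet> x = axis v 1 \<bullet> (G1 *v axis v 1)"
      using green_orthogonal[OF g1, of "axis v 1"] by (simp add: x_def y_def inner_diff_left)
    then have G1: "G1 $ v $ v = y v \<bullet> x" by (simp add: diag_entry_inner)
    define f where "f = (\<chi> u. x $ u / d $ u)"
    have x: "x = ?S f" using d by (simp add: f_def diag_vector vec_eq_iff)
    have "z2 \<bullet> ?S (y v) = 0" using y Sadj[of z2 "y v"] dz by simp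
    then have w: "M2 *v (G2 *v ?S (y v)) = ?S (y v)" by (rule green_solves[OF g2])
    define w where "w = G2 *v ?S (y v)"
    have M2w: "M2 *v w = ?S (y v)" using w by (simp add: w_def)
    \<comment> \<open>Completing the square: \<open>f = w / \<kappa>\<close> maximizes \<open>2 f \<bullet> S y - \<kappa> f \<bullet> M2 f\<close>.\<close>
    have "0 \<le> (\<kappa> *\<^sub>R f - w) \<bullet> (M2 *v (\<kappa> *\<^sub>R f - w))" using g2 by (simp add: is_green_def)
    also have "\<dots> = \<kappa>\<^sup>2 * (f \<bullet> (M2 *v f)) - \<kappa> * (f \<bullet> (M2 *v w)) - \<kappa> * (w \<bullet> (M2 *v f)) + w \<bullet> (M2 *v w)"
      by (simp add: matrix_vector_mult_diff_distrib matrix_vector_mult_scaleR inner_diff_left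
          inner_diff_right algebra_simps power2_eq_square)
    also have "w \<bullet> (M2 *v f) = f \<bullet> ?S (y v)"
      using symmetric_inner[OF symM2, of w f] M2w by (simp add: inner_commute)
    finally have 1: "2 * \<kappa> * (f \<bullet> ?S (y v)) \<le> \<kappa> * (\<kappa> * (f \<bullet> (M2 *v f))) + w \<bullet> ?S (y v)"
      by (simp add: M2w power2_eq_square algebra_simps)
    have "\<kappa> * (f \<bullet> (M2 *v f)) \<le> y v \<bullet> x"
      using le[of f] by (simp add: x[symmetric] M1x inner_commute)
    then have "\<kappa> * (\<kappa> * (f \<bullet> (M2 *v f))) \<le> \<kappa> * (y v \<bullet> x)" using \<kappa> by simp
    moreover have "f \<bullet> ?S (y v) = y v \<bullet> x" using Sadj[of f "y v"] unfolding x by (simp only: inner_commute)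
    ultimately show ?thesis using 1 by (simp add: G1 w_def inner_commute)
  qed
  \<comment> \<open>The mixed terms add up to twice the value at \<open>h\<close>, so in total the projection only lowers the trace.\<close>
  have expand: "?S (y v) \<bullet> (G2 *v ?S (y v)) =
      (d $ v)\<^sup>2 * G2 $ v $ v - 2 * (h $ v * (G2 *v h) $ v) + (z1 $ v)\<^sup>2 * (h \<bullet> (G2 *v h))" for v
  proof -
    have "?S (axis v 1) = d $ v *\<^sub>R axis v 1"
      by (simp add: diag_vector vec_eq_iff axis_def)
    then have S: "?S (y v) = d $ v *\<^sub>R axis v 1 - z1 $ v *\<^sub>R h"
      by (simp add: y_def h_def matrix_vector_mult_diff_distrib matrix_vector_mult_scaleR)
    have 1: "h \<bullet> (G2 *v axis v 1) = (G2 *v h) $ v"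
      using symmetric_inner[OF symG2, of h "axis v 1"] by (simp add: inner_axis)
    have 2: "axis v 1 \<bullet> (G2 *v h) = (G2 *v h) $ v" by (simp add: inner_axis')
    have 3: "axis v 1 \<bullet> (G2 *v axis v 1) = G2 $ v $ v" by (simp add: diag_entry_inner)
    have h: "h $ v = d $ v * z1 $ v" by (simp add: h_def diag_vector)
    show ?thesis unfolding S
      by (simp add: matrix_vector_mult_diff_distrib matrix_vector_mult_scaleR inner_diff_left
          inner_diff_right 1 2 3)
        (simp add: h power2_eq_square algebra_simps)
  qed
  have "\<kappa> * trace G1 \<le> (\<Sum>v\<in>UNIV. ?S (y v) \<bullet> (G2 *v ?S (y v)))"
    by (simp add: trace_def sum_distrib_left sum_mono main)
  also have "\<dots> = (\<Sum>v\<in>UNIV. (d $ v)\<^sup>2 * G2 $ v $ v) - 2 * (h \<bullet> (G2 *v h)) + (z1 \<bullet> z1) * (h \<bullet> (G2 *v h))"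
    unfolding expand sum.distrib sum_subtractf sum_distrib_left[symmetric] sum_distrib_right[symmetric]
    by (simp add: inner_vec_def power2_eq_square)
  also have "\<dots> \<le> (\<Sum>v\<in>UNIV. (d $ v)\<^sup>2 * G2 $ v $ v)"
    using green_psd[OF g2, of h] by (simp add: zz)
  also have "\<dots> \<le> (\<Sum>v\<in>UNIV. m * G2 $ v $ v)"
    using green_psd[OF g2] by (intro sum_mono mult_right_mono m) (simp add: diag_entry_inner)
  finally show ?thesis by (simp add: trace_def sum_distrib_left)
qed

lemma laplacian_form:
  fixes C :: "real ^ 'n ^ 'n"
  assumes "transpose C = C"
  shows "f \<bullet> (laplacian C *v f) = (\<Sum>u\<in>UNIV. \<Sum>v\<in>UNIV. C $ u $ v * (f $ u - f $ v)\<^sup>2) / 2"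
proof -
  have sym: "C $ u $ v = C $ v $ u" for u v using assms by (metis transpose_def vec_lambda_beta)
  have 1: "f \<bullet> (laplacian C *v f) =
      (\<Sum>u\<in>UNIV. \<Sum>v\<in>UNIV. C $ u $ v * (f $ u)\<^sup>2) - (\<Sum>u\<in>UNIV. \<Sum>v\<in>UNIV. C $ u $ v * f $ u * f $ v)"
  proof -
    have "laplacian C *v f = (\<chi> u. (\<Sum>v\<in>UNIV. C $ u $ v) * f $ u) - C *v f"
      by (simp add: laplacian_def matrix_vector_mult_diff_rdistrib diag_vector)
        (simp add: matrix_vector_mult_def)
    then show ?thesis
      by (simp add: inner_diff_right)
        (simp add: inner_vec_def matrix_vector_mult_def sum_distrib_left sum_distrib_right
          power2_eq_square mult_ac)
  qed
  have 2: "(\<Sum>u\<in>UNIV. \<Sum>v\<in>UNIV. C $ u $ v * (f $ v)\<^sup>2) = (\<Sum>u\<in>UNIV. \<Sum>v\<in>UNIV. C $ u $ v * (f $ u)\<^sup>2)"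
    by (subst sum.swap) (simp add: sym)
  have "(\<Sum>u\<in>UNIV. \<Sum>v\<in>UNIV. C $ u $ v * (f $ u - f $ v)\<^sup>2) =
     (\<Sum>u\<in>UNIV. \<Sum>v\<in>UNIV. C $ u $ v * (f $ u)\<^sup>2) + (\<Sum>u\<in>UNIV. \<Sum>v\<in>UNIV. C $ u $ v * (f $ v)\<^sup>2)
     - 2 * (\<Sum>u\<in>UNIV. \<Sum>v\<in>UNIV. C $ u $ v * f $ u * f $ v)"
    by (simp add: sum.distrib[symmetric] sum_subtractf[symmetric] sum_distrib_left power2_diff algebra_simps)
  then show ?thesis using 1 2 by simp
qed

text \<open>
  Since
  \<open>R\<^sub>u\<^sub>v = G\<^sub>u\<^sub>u + G\<^sub>v\<^sub>v - 2 G\<^sub>u\<^sub>v\<close>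
  and the rows of \<open>G\<close> sum to zero, averaging over all pairs leaves the trace.
\<close>

lemma avg_eff_resistance_green:
  fixes E :: "('n::finite) set set"
  assumes g: "is_green (laplacian (adjacency E)) (c *\<^sub>R 1) G"
  shows "avg_eff_resistance E = trace G / real CARD('n)"
proof -
  have c: "c \<noteq> 0" using g by (auto simp: is_green_def)
  have "c *\<^sub>R (G *v 1) = 0" using g by (simp add: is_green_def matrix_vector_mult_scaleR)
  then have "G *v 1 = 0" using c by simp
  then have row: "(\<Sum>v\<in>UNIV. G $ u $ v) = 0" for u
    by (simp add: vec_eq_iff matrix_vector_mult_def)
  have sym: "G $ u $ v = G $ v $ u" for u v
    using g by (metis is_green_def transpose_def vec_lambda_beta)
  have eff: "eff_resistance (adjacency E) u v = G $ u $ u + G $ v $ v - 2 * G $ u $ v" for u v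
    unfolding eff_resistance_def pseudoinverse_green[OF g]
    by (simp add: matrix_vector_mult_diff_distrib inner_diff_left inner_diff_right sym
        flip: diag_entry_inner)
  have "(\<Sum>u\<in>UNIV. \<Sum>v\<in>UNIV. eff_resistance (adjacency E) u v) = 2 * real CARD('n) * trace G"
    by (simp add: eff sum.distrib sum_subtractf row trace_def flip: sum_distrib_left)
  then show ?thesis by (simp add: avg_eff_resistance_def power2_eq_square)
qed

section \<open>The invariant measure\<close>

lemma invariant_positive_along_paths:
  fixes P :: "real ^ 'n ^ 'n"
  assumes "\<And>u v. 0 \<le> P $ u $ v" "\<And>u. 0 \<le> x $ u" "x v* P = x"
    and "(u, v) \<in> (dir_graph P)\<^sup>*" "0 < x $ u"
  shows "0 < x $ v"
  using assms(4,5)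
proof (induction rule: rtrancl_induct)
  case (step v w)
  have "0 < P $ v $ w * x $ v"
    using step assms(1)[of v w] by (auto simp: dir_graph_def order_less_le)
  also have "\<dots> \<le> (\<Sum>i\<in>UNIV. P $ i $ w * x $ i)"
    by (rule member_le_sum) (auto simp: assms(1,2))
  also have "\<dots> = (x v* P) $ w" by (simp add: vector_matrix_mult_def mult.commute)
  finally show ?case by (simp add: assms)
qed

text \<open>
  A fixed point of \<open>x \<mapsto> x\<^sup>T P\<close> on the probability simplex exists by
  Brouwer's theorem; some entry of it is positive, and strong connectivity carries positivity to
  all others.
\<close>

lemma invariant_measure_exists:
  fixes P :: "real ^ 'n ^ 'n"
  assumes "consensus_matrix P"
  obtains \<pi> where "\<And>u. 0 < \<pi> $ u" "\<pi> v* P = \<pi>" "(\<Sum>u\<in>UNIV. \<pi> $ u) = 1"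
proof -
  have nn: "0 \<le> P $ u $ v" for u v using assms by (simp add: consensus_matrix_def)
  have row: "(\<Sum>v\<in>UNIV. P $ u $ v) = 1" for u
    using assms by (auto simp: consensus_matrix_def vec_eq_iff matrix_vector_mult_def)
  define S where "S = {x :: real ^ 'n. (\<forall>u. 0 \<le> x $ u) \<and> (\<Sum>u\<in>UNIV. x $ u) = 1}"
  have "closed S" unfolding S_def
    by (intro closed_Collect_conj closed_Collect_all closed_Collect_le closed_Collect_eq)
      (auto intro!: continuous_intros)
  moreover have "bounded S"
    unfolding bounded_iff
  proof (intro exI ballI)
    fix x assume "x \<in> S"
    have "norm x \<le> (\<Sum>u\<in>UNIV. \<bar>x $ u\<bar>)" by (rule norm_le_l1_cart)
    also have "\<dots> = 1" using \<open>x \<in> S\<close> by (simp add: S_def)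
    finally show "norm x \<le> 1" .
  qed
  ultimately have "compact S" by (simp add: compact_eq_bounded_closed)
  moreover have "convex S"
    by (auto simp: S_def convex_def sum.distrib simp flip: sum_distrib_left)
  moreover have "(\<chi> u. 1 / real CARD('n)) \<in> S" by (simp add: S_def)
  then have "S \<noteq> {}" by blast
  moreover have "continuous_on S (\<lambda>x. x v* P)"
    unfolding vector_matrix_mult_def by (intro continuous_intros)
  moreover have "(\<lambda>x. x v* P) \<in> S \<rightarrow> S"
  proof
    fix x assume x: "x \<in> S"
    have "(\<Sum>v\<in>UNIV. (x v* P) $ v) = (\<Sum>u\<in>UNIV. x $ u * (\<Sum>v\<in>UNIV. P $ u $ v))"
      unfolding vector_matrix_mult_def sum_distrib_left vec_lambda_beta
      by (subst sum.swap) (simp add: mult.commute)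
    then show "x v* P \<in> S"
      using x nn by (auto simp: S_def row vector_matrix_mult_def intro!: sum_nonneg)
  qed
  ultimately obtain \<pi> where \<pi>: "\<pi> \<in> S" "\<pi> v* P = \<pi>"
    using brouwer[of S "\<lambda>x. x v* P"] by blast
  have nonneg: "0 \<le> \<pi> $ u" for u using \<pi> by (simp add: S_def)
  have "\<exists>u. 0 < \<pi> $ u"
  proof (rule ccontr)
    assume "\<not> (\<exists>u. 0 < \<pi> $ u)"
    then have "\<pi> $ u = 0" for u using nonneg[of u] by (simp add: order_less_le)
    then show False using \<pi>(1) by (simp add: S_def)
  qed
  then obtain u where "0 < \<pi> $ u" ..
  then have "0 < \<pi> $ v" for v
    using invariant_positive_along_paths[OF nn nonneg \<pi>(2), of u v] assms
    by (simp add: consensus_matrix_def strongly_connected_def)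
  then show ?thesis by (intro that) (use \<pi> in \<open>auto simp: S_def\<close>)
qed

text \<open>
  Subtract from \<open>y\<close> the largest multiple of \<open>x\<close> that leaves a
  nonnegative vector. The difference is invariant and vanishes somewhere, hence everywhere,
  because a positive entry would spread along paths.
\<close>

lemma invariant_measure_unique:
  fixes P :: "real ^ 'n ^ 'n"
  assumes P: "consensus_matrix P"
    and x: "\<And>u. 0 < x $ u" "x v* P = x" "(\<Sum>u\<in>UNIV. x $ u) = 1"
    and y: "\<And>u. 0 < y $ u" "y v* P = y" "(\<Sum>u\<in>UNIV. y $ u) = 1"
  shows "x = y"
proof -
  define \<rho> where "\<rho> = Min (range (\<lambda>u. y $ u / x $ u))"
  have "\<rho> \<in> range (\<lambda>u. y $ u / x $ u)" unfolding \<rho>_def by (intro Min_in) auto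
  then obtain u where u: "\<rho> = y $ u / x $ u" by blast
  have le: "\<rho> \<le> y $ v / x $ v" for v unfolding \<rho>_def by simp
  define d where "d = y - \<rho> *\<^sub>R x"
  have nn: "0 \<le> d $ v" for v
    using le[of v] x(1)[of v] by (simp add: d_def pos_le_divide_eq)
  have inv: "d v* P = d"
    using x(2) y(2) by (simp add: d_def vec_eq_iff vector_matrix_mult_def algebra_simps
      sum_subtractf flip: sum_distrib_left)
  have "d $ u = 0" using u x(1)[of u] by (simp add: d_def)
  then have "d $ v = 0" for v
    using invariant_positive_along_paths[of P d v u] nn[of v] nn inv P
    by (force simp: consensus_matrix_def strongly_connected_def order_less_le)
  then have eq: "y $ v = \<rho> * x $ v" for v by (simp add: d_def)
  then have "\<rho> = 1" using x(3) y(3) by (simp flip: sum_distrib_left)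
  then show ?thesis using eq by (simp add: vec_eq_iff)
qed

lemma invariant_measure:
  fixes P :: "real ^ 'n ^ 'n"
  assumes "consensus_matrix P"
  shows "0 < invariant_measure P $ u" "invariant_measure P v* P = invariant_measure P"
    "(\<Sum>u\<in>UNIV. invariant_measure P $ u) = 1"
proof -
  obtain \<pi> where \<pi>: "\<And>u. 0 < \<pi> $ u" "\<pi> v* P = \<pi>" "(\<Sum>u\<in>UNIV. \<pi> $ u) = 1"
    using invariant_measure_exists[OF assms] by blast
  have "invariant_measure P = \<pi>"
    unfolding invariant_measure_def
    by (rule the_equality) (use \<pi> in simp, metis \<pi> invariant_measure_unique[OF assms])
  then show "0 < invariant_measure P $ u" "invariant_measure P v* P = invariant_measure P"
    "(\<Sum>u\<in>UNIV. invariant_measure P $ u) = 1" using \<pi> by auto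
qed

section \<open>The Neumann series of traces\<close>

lemma mat_power_add: "mat_power A (i + j) = mat_power A i ** mat_power A j"
  by (induction i) (simp_all add: matrix_mul_assoc)

lemma mat_power_fixed: "A *v x = x \<Longrightarrow> mat_power A t *v x = x"
  by (induction t) (simp_all flip: matrix_vector_mul_assoc)

lemma trace_outer: "trace (outer x y) = x \<bullet> y"
  by (simp add: trace_def outer_def inner_vec_def)

lemma matrix_mult_outer: "A ** outer x y = outer (A *v x) y"
  by (simp add: vec_eq_iff outer_def matrix_matrix_mult_def matrix_vector_mult_def sum_distrib_right mult.assoc)

lemma outer_matrix_mult: "outer x y ** A = outer x (transpose A *v y)"
  by (simp add: vec_eq_iff outer_def matrix_matrix_mult_def matrix_vector_mult_def transpose_def
      sum_distrib_left mult_ac)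

lemma outer_zero: "outer x 0 = 0" "outer 0 x = 0"
  by (simp_all add: vec_eq_iff outer_def)

lemma matrix_diff_mult: "(A - B) ** C = A ** C - B ** (C :: real ^ 'n ^ 'n)"
  and matrix_mult_diff: "C ** (A - B) = C ** A - C ** (B :: real ^ 'n ^ 'n)"
  by (simp_all add: vec_eq_iff matrix_matrix_mult_def algebra_simps sum_subtractf)

lemma transpose_diff: "transpose (A - B) = transpose A - transpose B"
  by (simp add: vec_eq_iff transpose_def)

text \<open>
  If \<open>A\<close> fixes the unit vector \<open>s\<close> from both sides, then
  \<open>A\<close> splits into \<open>ss\<^sup>T\<close> and an orthogonal remainder, so removing
  \<open>ss\<^sup>T\<close> costs exactly \<open>1\<close> in the squared Frobenius norm.
\<close>

lemma trace_deviation: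
  fixes A :: "real ^ 'n ^ 'n"
  assumes "A *v s = s" "transpose A *v s = s" "norm s = 1"
  shows "trace ((A - outer s s) ** transpose (A - outer s s)) = trace (A ** transpose A) - 1"
  using assms
  by (simp add: matrix_diff_mult matrix_mult_diff transpose_diff transpose_outer matrix_mult_outer
      outer_matrix_mult trace_sub trace_outer outer_vector norm_eq_1
      matrix_vector_mult_diff_rdistrib)

text \<open>
  The Neumann series of \<open>G\<close>, at the level of traces. Because
  \<open>(I - K) G = I - ss\<^sup>T\<close>, each term telescopes:
  \<open>tr K\<^sup>t - 1 = tr(K\<^sup>t G) - tr(K\<^sup>t\<^sup>+\<^sup>1 G)\<close>. For even
  \<open>t\<close> the number \<open>tr(K\<^sup>t G)\<close> is nonnegative, which bounds the
  partial sums of the nonnegative terms by \<open>tr G\<close>. Their summability in turn forces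
  \<open>K\<^sup>t - ss\<^sup>T\<close> to tend to zero in Frobenius norm, and with it the
  remainder \<open>tr(K\<^sup>t G)\<close>.
\<close>

lemma trace_power_sums:
  fixes K :: "real ^ 'n ^ 'n"
  assumes sym: "transpose K = K" and Ks: "K *v s = s" and g: "is_green (mat 1 - K) s G"
    and ge: "\<And>t. 1 \<le> trace (mat_power K t)"
  shows "(\<lambda>t. trace (mat_power K t) - 1) sums trace G"
proof -
  have ss: "norm s = 1" and Gs: "G *v s = 0" and symG: "transpose G = G"
    and MG: "(mat 1 - K) ** G = mat 1 - outer s s" using g by (auto simp: is_green_def)
  have symt: "transpose (mat_power K t) = mat_power K t" for t by (simp add: transpose_mat_power sym)
  have fix_s: "mat_power K t *v s = s" for t by (rule mat_power_fixed[OF Ks])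
  define a where "a t = trace (mat_power K t ** G)" for t
  have step: "trace (mat_power K t) - 1 = a t - a (Suc t)" for t
  proof -
    have "mat_power K t - outer s s = mat_power K t ** (mat 1 - outer s s)"
      by (simp add: matrix_mult_diff matrix_mult_outer fix_s)
    also have "\<dots> = mat_power K t ** G - mat_power K (Suc t) ** G"
      unfolding MG[symmetric] mat_power_Suc_right
      by (simp add: matrix_diff_mult matrix_mult_diff matrix_mul_assoc)
    finally show ?thesis using ss
      by (metis a_def norm_eq_1 trace_outer trace_sub)
  qed
  have partial: "(\<Sum>t<T. trace (mat_power K t) - 1) = trace G - a T" for T
    unfolding step sum_lessThan_telescope' by (simp add: a_def)
  have a_even: "0 \<le> a (2 * j)" for j
  proof -
    have "a (2 * j) = trace (mat_power K j ** (mat_power K j ** G))"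
      by (simp add: a_def mult_2 mat_power_add matrix_mul_assoc)
    also have "\<dots> = trace (mat_power K j ** G ** mat_power K j)"
      by (rule trace_mul_sym)
    also have "\<dots> = (\<Sum>v\<in>UNIV. (mat_power K j *v axis v 1) \<bullet> (G *v (mat_power K j *v axis v 1)))"
      unfolding trace_def diag_entry_inner
      by (simp add: symmetric_inner[OF symt] flip: matrix_vector_mul_assoc)
    also have "\<dots> \<ge> 0" by (intro sum_nonneg green_psd[OF g])
    finally show ?thesis .
  qed
  have summ: "summable (\<lambda>t. trace (mat_power K t) - 1)"
  proof (rule summableI_nonneg_bounded)
    fix T
    have "(\<Sum>t<T. trace (mat_power K t) - 1) \<le> (\<Sum>t<2 * T. trace (mat_power K t) - 1)"
      by (rule sum_mono2) (use ge in auto)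
    also have "\<dots> \<le> trace G" using partial[of "2 * T"] a_even[of T] by simp
    finally show "(\<Sum>t<T. trace (mat_power K t) - 1) \<le> trace G" .
  qed (use ge in simp)
  have bound: "(a j)\<^sup>2 \<le> (trace (mat_power K (2 * j)) - 1) * trace (G ** transpose G)" for j
  proof -
    let ?H = "mat_power K j - outer s s"
    have "?H ** G = mat_power K j ** G"
      by (simp add: matrix_diff_mult outer_matrix_mult symG Gs outer_zero)
    moreover have "trace (?H ** transpose ?H) = trace (mat_power K (2 * j)) - 1"
      by (subst trace_deviation) (simp_all add: fix_s ss symt mult_2 mat_power_add)
    ultimately show ?thesis using trace_Cauchy_Schwarz[of ?H G] by (simp add: a_def)
  qed
  have "(\<lambda>j. trace (mat_power K (2 * j)) - 1) \<longlonglongrightarrow> 0"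
    using LIMSEQ_subseq_LIMSEQ[OF summable_LIMSEQ_zero[OF summ], of "\<lambda>j. 2 * j"]
    by (simp add: o_def strict_mono_def)
  then have "(\<lambda>j. (trace (mat_power K (2 * j)) - 1) * trace (G ** transpose G)) \<longlonglongrightarrow> 0"
    by (rule tendsto_mult_left_zero)
  then have "(\<lambda>j. (a j)\<^sup>2) \<longlonglongrightarrow> 0"
    by (rule tendsto_sandwich[rotated -1, where f="\<lambda>_. 0"]) (auto simp: bound)
  then have "a \<longlonglongrightarrow> 0" by (simp add: power_tendsto_0_iff)
  from telescope_sums'[OF this] show ?thesis by (simp add: step a_def)
qed

section \<open>Graphs and extreme entries\<close>

text \<open>
  Comparing two points through a common centre \<open>x\<close> costs a factor \<open>2\<close>,
  and each point belongs to \<open>card N - 1\<close> pairs, counted in both orders. For a single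
  point both sides vanish.
\<close>

lemma sum_pairs_le_star:
  fixes f :: "'a \<Rightarrow> real"
  assumes "finite N"
  shows "(\<Sum>u\<in>N. \<Sum>v\<in>N. (f u - f v)\<^sup>2) \<le> 4 * (real (card N) - 1) * (\<Sum>u\<in>N. (f u - x)\<^sup>2)"
proof -
  let ?a = "\<lambda>u. (f u - x)\<^sup>2"
  have "(f u - f v)\<^sup>2 \<le> 2 * ?a u + 2 * ?a v - (if u = v then 4 * ?a u else 0)" for u v
  proof (cases "u = v")
    case False
    have "0 \<le> ((f u - x) + (f v - x))\<^sup>2" by simp
    then show ?thesis using False by (simp add: power2_eq_square algebra_simps)
  qed simp
  then have "(\<Sum>u\<in>N. \<Sum>v\<in>N. (f u - f v)\<^sup>2) \<le>
      (\<Sum>u\<in>N. \<Sum>v\<in>N. 2 * ?a u + 2 * ?a v - (if u = v then 4 * ?a u else 0))"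
    by (intro sum_mono)
  also have "\<dots> = 4 * (real (card N) - 1) * sum ?a N"
    using assms
    by (simp add: sum.distrib sum_subtractf algebra_simps flip: sum_distrib_left sum_distrib_right)
  finally show ?thesis .
qed

lemma adjacency_undir_graph:
  "adjacency (undir_graph P) $ u $ v = (if P $ u $ v \<noteq> 0 \<or> P $ v $ u \<noteq> 0 then 1 else 0)"
  by (auto simp: adjacency_def undir_graph_def doubleton_eq_iff)

lemma transpose_adjacency: "transpose (adjacency E) = adjacency E"
  by (simp add: vec_eq_iff transpose_def adjacency_def insert_commute)

lemma finite_nonzero_entries: "finite {(P :: real ^ 'n ^ 'n) $ u $ v |u v. P $ u $ v \<noteq> 0}"
  by (rule finite_subset[of _ "range (\<lambda>(u, v). P $ u $ v)"]) auto

lemma min_nonzero_entry_le: "P $ u $ v \<noteq> 0 \<Longrightarrow> min_nonzero_entry P \<le> P $ u $ v"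
  unfolding min_nonzero_entry_def by (intro Min_le finite_nonzero_entries) auto

lemma max_nonzero_entry_ge: "P $ u $ v \<noteq> 0 \<Longrightarrow> P $ u $ v \<le> max_nonzero_entry P"
  unfolding max_nonzero_entry_def by (intro Max_ge finite_nonzero_entries) auto

lemma min_entry_le: "min_entry x \<le> x $ u"
  and max_entry_ge: "x $ u \<le> max_entry x"
  by (simp_all add: min_entry_def max_entry_def)

lemma max_in_degree_ge: "card {u. u \<noteq> v \<and> (u, v) \<in> E} \<le> max_in_degree E"
  by (simp add: max_in_degree_def)

section \<open>Entries of the time reversal\<close>

lemma matrix_inv_eq:
  fixes A B :: "real ^ 'n ^ 'n"
  assumes "A ** B = mat 1" shows "matrix_inv A = B"
  unfolding matrix_inv_def
proof (rule some_equality)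
  show "A ** B = mat 1 \<and> B ** A = mat 1" using assms by (simp add: matrix_left_right_inverse)
  show "X = B" if "A ** X = mat 1 \<and> X ** A = mat 1" for X
    using that assms by (metis matrix_mul_assoc matrix_mul_lid matrix_mul_rid)
qed

lemma diag_mult: "(diag x ** M) $ u $ v = x $ u * M $ u $ v"
  and mult_diag: "(M ** diag x) $ u $ v = M $ u $ v * x $ v"
  by (simp_all add: diag_def matrix_matrix_mult_def if_distrib[of "\<lambda>x. x * _"]
      if_distrib[of "\<lambda>x. _ * x"] cong: if_cong)

lemma time_reversal_entry:
  assumes "\<And>u. 0 < invariant_measure P $ u"
  shows "time_reversal P $ u $ v =
    invariant_measure P $ v * P $ v $ u / invariant_measure P $ u"
proof -
  let ?\<pi> = "invariant_measure P"
  have nz: "?\<pi> $ u \<noteq> 0" for u using assms[of u] by simp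
  have "diag ?\<pi> ** diag (\<chi> u. 1 / ?\<pi> $ u) = mat 1"
    using nz by (simp add: vec_eq_iff diag_mult) (simp add: diag_def mat_def)
  then have "matrix_inv (diag ?\<pi>) = diag (\<chi> u. 1 / ?\<pi> $ u)" by (rule matrix_inv_eq)
  then show ?thesis
    by (simp add: time_reversal_def mult_diag diag_mult transpose_def)
qed

section \<open>The symmetrized chain and its resistor network\<close>

locale consensus_chain =
  fixes P :: "real ^ 'n ^ 'n" and \<pi> :: "real ^ 'n"
  assumes consensus: "consensus_matrix P"
    and pos: "\<And>u. 0 < \<pi> $ u"
    and invariant: "\<pi> v* P = \<pi>"
    and total: "(\<Sum>u\<in>UNIV. \<pi> $ u) = 1"
begin

lemma nonneg: "0 \<le> P $ u $ v" and diag_pos: "0 < P $ u $ u"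
  using consensus by (auto simp: consensus_matrix_def)

lemma row_sum: "(\<Sum>v\<in>UNIV. P $ u $ v) = 1"
  using consensus by (auto simp: consensus_matrix_def vec_eq_iff matrix_vector_mult_def)

lemma column_sum: "(\<Sum>u\<in>UNIV. \<pi> $ u * P $ u $ v) = \<pi> $ v"
proof -
  have "(\<Sum>u\<in>UNIV. \<pi> $ u * P $ u $ v) = (\<pi> v* P) $ v"
    by (simp add: vector_matrix_mult_def mult.commute)
  then show ?thesis by (simp add: invariant)
qed

lemma min_nonzero_entry_pos: "0 < min_nonzero_entry P"
proof -
  have "min_nonzero_entry P \<in> {P $ u $ v |u v. P $ u $ v \<noteq> 0}"
    unfolding min_nonzero_entry_def
    by (intro Min_in finite_nonzero_entries) (use diag_pos in \<open>auto simp: order_less_le\<close>)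
  then obtain u v where "min_nonzero_entry P = P $ u $ v" "P $ u $ v \<noteq> 0" by blast
  then show ?thesis using nonneg[of u v] by simp
qed

lemma max_nonzero_entry_pos: "0 < max_nonzero_entry P"
  using less_le_trans[OF diag_pos max_nonzero_entry_ge] diag_pos by (simp add: order_less_le)

lemma min_entry_pos: "0 < min_entry \<pi>"
  by (simp add: min_entry_def pos)

lemma max_entry_pos: "0 < max_entry \<pi>"
  using max_entry_ge[of \<pi>] pos by (meson less_le_trans)

lemma card_max_entry: "1 \<le> real CARD('n) * max_entry \<pi>"
  using sum_mono[of UNIV "\<lambda>u. \<pi> $ u" "\<lambda>_. max_entry \<pi>"] by (simp add: total max_entry_ge)

lemma card_min_entry: "real CARD('n) * min_entry \<pi> \<le> 1"
  using sum_mono[of UNIV "\<lambda>_. min_entry \<pi>" "\<lambda>u. \<pi> $ u"] by (simp add: total min_entry_le)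

text \<open>
  \<open>A = \<Pi>\<^sup>1\<^sup>/\<^sup>2 P \<Pi>\<^sup>-\<^sup>1\<^sup>/\<^sup>2\<close> is
  \<open>P\<close> in an orthonormal basis of the space weighted by \<open>\<pi>\<close>. There
  the time reversal becomes the transpose, \<open>K\<close> is the matrix of
  \<open>P\<^sup>* P\<close>, and \<open>s = \<Pi>\<^sup>1\<^sup>/\<^sup>2 1\<close> is the common
  fixed vector.
\<close>

definition s :: "real ^ 'n" where "s = (\<chi> u. sqrt (\<pi> $ u))"

definition A :: "real ^ 'n ^ 'n" where "A = (\<chi> u v. s $ u * P $ u $ v / s $ v)"

definition K :: "real ^ 'n ^ 'n" where "K = transpose A ** A"

text \<open>
  The symmetric matrix \<open>P\<^sup>T \<Pi> P\<close>, that is, the conductances of the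
  reversible chain \<open>P\<^sup>* P\<close>.
\<close>

definition conductance :: "real ^ 'n ^ 'n" where
  "conductance = (\<chi> u v. \<Sum>w\<in>UNIV. \<pi> $ w * P $ w $ u * P $ w $ v)"

lemma s_pos: "0 < s $ u" and s_mult: "s $ u * s $ u = \<pi> $ u"
  using pos[of u] by (simp_all add: s_def)

lemma s_nz: "s $ u \<noteq> 0"
  using s_pos[of u] by simp

lemma norm_s: "norm s = 1"
  by (simp add: norm_eq_1 inner_vec_def s_mult total)

lemma A_s: "A *v s = s"
  using s_nz by (simp add: vec_eq_iff A_def matrix_vector_mult_def row_sum flip: sum_distrib_left)

lemma AT_s: "transpose A *v s = s"
proof -
  have "(transpose A *v s) $ v = s $ v" for v
  proof -
    have "(transpose A *v s) $ v = (\<Sum>u\<in>UNIV. s $ u * s $ u * P $ u $ v / s $ v)"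
      unfolding A_def matrix_vector_mult_def transpose_def vec_lambda_beta
      by (intro sum.cong) (simp_all add: mult_ac)
    also have "\<dots> = \<pi> $ v / s $ v"
      by (simp add: s_mult column_sum flip: sum_divide_distrib)
    also have "\<dots> = s $ v" using s_nz[of v] by (simp add: s_mult[symmetric])
    finally show ?thesis .
  qed
  then show ?thesis by (simp add: vec_eq_iff)
qed

lemma K_s: "K *v s = s"
  by (simp only: K_def A_s AT_s matrix_vector_mul_assoc[symmetric])

lemma K_sym: "transpose K = K"
  by (simp add: K_def matrix_transpose_mul)

lemma K_entry: "K $ u $ v = conductance $ u $ v / (s $ u * s $ v)"
proof -
  have "K $ u $ v = (\<Sum>w\<in>UNIV. (s $ w * s $ w) * P $ w $ u * P $ w $ v / (s $ u * s $ v))"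
    unfolding K_def A_def matrix_matrix_mult_def transpose_def vec_lambda_beta
    by (intro sum.cong) (simp_all add: mult_ac)
  then show ?thesis by (simp add: s_mult conductance_def sum_divide_distrib)
qed

lemma conductance_sym: "transpose conductance = conductance"
  by (simp add: vec_eq_iff conductance_def transpose_def mult_ac)

lemma conductance_row_sum: "(\<Sum>v\<in>UNIV. conductance $ u $ v) = \<pi> $ u"
proof -
  have "(\<Sum>v\<in>UNIV. conductance $ u $ v) = (\<Sum>w\<in>UNIV. \<pi> $ w * P $ w $ u * (\<Sum>v\<in>UNIV. P $ w $ v))"
    unfolding conductance_def vec_lambda_beta sum_distrib_left by (rule sum.swap)
  then show ?thesis by (simp add: row_sum column_sum)
qed

text \<open>
  The form of \<open>I - P\<^sup>* P\<close> in the weighted space is the energy of the resistor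
  network with conductances \<open>P\<^sup>T \<Pi> P\<close>, whose vertex weights are
  \<open>\<pi>\<close> by row stochasticity and invariance.
\<close>

lemma one_minus_K_form:
  "(diag s *v f) \<bullet> ((mat 1 - K) *v (diag s *v f)) = f \<bullet> (laplacian conductance *v f)"
proof -
  have "(diag s *v f) $ u * ((mat 1 - K) *v (diag s *v f)) $ u =
      f $ u * (laplacian conductance *v f) $ u" for u
  proof -
    have 1: "(K *v (diag s *v f)) $ u = (conductance *v f) $ u / s $ u"
      unfolding diag_vector using s_nz
      by (simp add: matrix_vector_mult_def K_entry sum_divide_distrib)
    have 2: "(laplacian conductance *v f) $ u = \<pi> $ u * f $ u - (conductance *v f) $ u"
      by (simp add: laplacian_def matrix_vector_mult_diff_rdistrib diag_vector)
        (simp add: matrix_vector_mult_def conductance_row_sum)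
    show ?thesis
      unfolding matrix_vector_mult_diff_rdistrib matrix_vector_mul_lid vector_minus_component 1 2
      using s_nz[of u] by (simp add: diag_vector s_mult[symmetric] algebra_simps)
  qed
  then show ?thesis by (simp add: inner_vec_def)
qed

abbreviation "graph_laplacian \<equiv> laplacian (adjacency (undir_graph P))"

text \<open>
  The summand \<open>w = u\<close> alone suffices, thanks to the self loop at \<open>u\<close>.
\<close>

lemma conductance_ge:
  assumes "P $ u $ v \<noteq> 0"
  shows "min_entry \<pi> * (min_nonzero_entry P)\<^sup>2 \<le> conductance $ u $ v"
proof -
  have "min_entry \<pi> * (min_nonzero_entry P * min_nonzero_entry P) \<le> \<pi> $ u * (P $ u $ u * P $ u $ v)"
    using min_nonzero_entry_pos min_entry_pos assms diag_pos[of u] nonneg[of u v]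
    by (intro mult_mono min_entry_le min_nonzero_entry_le) (auto simp: less_imp_le pos)
  also have "\<dots> \<le> (\<Sum>w\<in>UNIV. \<pi> $ w * (P $ w $ u * P $ w $ v))"
    by (rule member_le_sum) (auto simp: nonneg less_imp_le[OF pos])
  finally show ?thesis by (simp add: conductance_def power2_eq_square mult.assoc)
qed

lemma conductance_nonneg: "0 \<le> conductance $ u $ v"
  unfolding conductance_def by (simp, intro sum_nonneg) (simp add: nonneg less_imp_le[OF pos])

lemma energy_ge:
  "min_entry \<pi> * (min_nonzero_entry P)\<^sup>2 * (f \<bullet> (graph_laplacian *v f))
    \<le> f \<bullet> (laplacian conductance *v f)"
proof -
  have sym: "conductance $ u $ v = conductance $ v $ u" for u v
    by (simp add: conductance_def mult_ac)
  have "min_entry \<pi> * (min_nonzero_entry P)\<^sup>2 * adjacency (undir_graph P) $ u $ v \<le> conductance $ u $ v" for u v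
    using conductance_ge[of u v] conductance_ge[of v u] conductance_nonneg[of u v]
    by (auto simp: adjacency_undir_graph sym[of v u])
  then have "(\<Sum>u\<in>UNIV. \<Sum>v\<in>UNIV. min_entry \<pi> * (min_nonzero_entry P)\<^sup>2 *
        adjacency (undir_graph P) $ u $ v * (f $ u - f $ v)\<^sup>2)
      \<le> (\<Sum>u\<in>UNIV. \<Sum>v\<in>UNIV. conductance $ u $ v * (f $ u - f $ v)\<^sup>2)"
    by (intro sum_mono mult_right_mono) auto
  then show ?thesis
    by (simp add: laplacian_form conductance_sym transpose_adjacency sum_distrib_left mult.assoc)
qed

lemma graph_energy_nonneg: "0 \<le> f \<bullet> (graph_laplacian *v f)"
  unfolding laplacian_form[OF transpose_adjacency]
  by (intro divide_nonneg_nonneg sum_nonneg) (auto simp: adjacency_undir_graph)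

text \<open>
  A function without energy is constant along every edge, hence along the directed paths that join
  any two vertices.
\<close>

lemma graph_energy_zero:
  assumes "f \<bullet> (graph_laplacian *v f) = 0" shows "f $ u = f $ v"
proof -
  let ?g = "\<lambda>u v. adjacency (undir_graph P) $ u $ v * (f $ u - f $ v)\<^sup>2"
  have nn: "0 \<le> ?g u v" for u v by (simp add: adjacency_undir_graph)
  have "(\<Sum>u\<in>UNIV. \<Sum>v\<in>UNIV. ?g u v) = 0"
    using assms by (simp add: laplacian_form[OF transpose_adjacency])
  then have "\<forall>u\<in>UNIV. (\<Sum>v\<in>UNIV. ?g u v) = 0"
    by (subst (asm) sum_nonneg_eq_0_iff) (auto intro!: sum_nonneg nn simp del: mult_eq_0_iff)
  then have "(\<Sum>v\<in>UNIV. ?g u v) = 0" for u by blast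
  then have g0: "?g u v = 0" for u v
    using sum_nonneg_eq_0_iff[of UNIV "?g u"] nn by simp
  have "(u, v) \<in> (dir_graph P)\<^sup>*"
    using consensus by (simp add: consensus_matrix_def strongly_connected_def)
  then show ?thesis
  proof (induction rule: rtrancl_induct)
    case (step v w)
    then show ?case using g0[of v w] by (simp add: adjacency_undir_graph dir_graph_def)
  qed simp
qed

lemma graph_green:
  obtains G where "is_green graph_laplacian ((1 / sqrt (real CARD('n))) *\<^sub>R 1) G"
proof (rule green_exists)
  have L: "laplacian C *v 1 = 0" for C :: "real ^ 'n ^ 'n"
    by (simp add: laplacian_def matrix_vector_mult_diff_rdistrib diag_vector vec_eq_iff)
  show "transpose graph_laplacian = graph_laplacian"
    using transpose_adjacency[of "undir_graph P"]
    by (auto simp: laplacian_def diag_def transpose_def vec_eq_iff)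
  show "graph_laplacian *v ((1 / sqrt (real CARD('n))) *\<^sub>R 1) = 0"
    by (simp add: matrix_vector_mult_scaleR L)
  show "norm ((1 / sqrt (real CARD('n))) *\<^sub>R (1 :: real ^ 'n)) = 1"
    by (simp add: norm_eq_sqrt_inner inner_vec_def)
  show "\<exists>c. x = c *\<^sub>R ((1 / sqrt (real CARD('n))) *\<^sub>R 1)" if "x \<bullet> (graph_laplacian *v x) = 0" for x
    using graph_energy_zero[OF that]
    by (intro exI[of _ "sqrt (real CARD('n)) * x $ undefined"]) (simp add: vec_eq_iff)
qed (rule graph_energy_nonneg)

lemma chain_green:
  obtains G where "is_green (mat 1 - K) s G"
proof (rule green_exists)
  have div: "x = diag s *v (\<chi> u. x $ u / s $ u)" for x :: "real ^ 'n"
    using s_nz by (simp add: diag_vector vec_eq_iff)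
  have ge: "min_entry \<pi> * (min_nonzero_entry P)\<^sup>2 * (f \<bullet> (graph_laplacian *v f)) \<le>
      x \<bullet> ((mat 1 - K) *v x)" if "f = (\<chi> u. x $ u / s $ u)" for f x
    using energy_ge[of f] one_minus_K_form[of f] div[of x] that by simp
  have pos: "0 < min_entry \<pi> * (min_nonzero_entry P)\<^sup>2"
    using min_entry_pos min_nonzero_entry_pos by simp
  show "transpose (mat 1 - K) = mat 1 - K"
    using K_sym by (simp add: transpose_diff)
  show "0 \<le> x \<bullet> ((mat 1 - K) *v x)" for x
    using ge[OF refl, of x] pos graph_energy_nonneg
    by (meson less_imp_le mult_nonneg_nonneg order_trans)
  show "(mat 1 - K) *v s = 0" by (simp add: matrix_vector_mult_diff_rdistrib K_s)
  show "norm s = 1" by (rule norm_s)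
  show "\<exists>c. x = c *\<^sub>R s" if "x \<bullet> ((mat 1 - K) *v x) = 0" for x
  proof -
    define f where "f = (\<chi> u. x $ u / s $ u)"
    have "f \<bullet> (graph_laplacian *v f) \<le> 0"
      using ge[OF f_def] mult_le_cancel_left_pos[OF pos, of _ 0] that by simp
    then have "f \<bullet> (graph_laplacian *v f) = 0" using graph_energy_nonneg[of f] by simp
    then have c: "f $ u = f $ undefined" for u by (rule graph_energy_zero)
    have "x $ u = f $ u * s $ u" for u using s_nz[of u] by (simp add: f_def)
    then have "x $ u = f $ undefined * s $ u" for u using c[of u] by simp
    then show ?thesis by (intro exI[of _ "f $ undefined"]) (simp add: vec_eq_iff)
  qed
qed

end

context consensus_chain
begin

lemma invariant_measure_eq: "invariant_measure P = \<pi>"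
  using invariant_measure_unique[OF consensus] invariant_measure[OF consensus]
    pos invariant total by metis

text \<open>
  The entries of \<open>PP\<^sup>* = P\<^sup>*P\<close>. A positive right-hand side means that
  \<open>u\<close> and \<open>v\<close> have a common in-neighbour, a positive left-hand side that
  they have a common out-neighbour; normality makes the two conditions equivalent. Self loops make
  every vertex its own neighbour here.
\<close>

lemma normal_entries:
  assumes "P ** time_reversal P = time_reversal P ** P"
  shows "(\<Sum>w\<in>UNIV. P $ u $ w * (\<pi> $ v * P $ v $ w / \<pi> $ w)) = conductance $ u $ v / \<pi> $ u"
proof -
  have R: "time_reversal P $ u $ v = \<pi> $ v * P $ v $ u / \<pi> $ u" for u v
    using time_reversal_entry[of P] pos by (simp add: invariant_measure_eq)
  have "(P ** time_reversal P) $ u $ v = (time_reversal P ** P) $ u $ v" using assms by simp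
  then show ?thesis
    by (simp add: matrix_matrix_mult_def R conductance_def sum_divide_distrib mult_ac)
qed

lemma normal_A:
  assumes "P ** time_reversal P = time_reversal P ** P"
  shows "A ** transpose A = transpose A ** A"
proof -
  have "(A ** transpose A) $ u $ v = K $ u $ v" for u v
  proof -
    have "(A ** transpose A) $ u $ v = (\<Sum>w\<in>UNIV. s $ u * P $ u $ w * (s $ v * P $ v $ w) / \<pi> $ w)"
      by (simp add: A_def matrix_matrix_mult_def transpose_def s_mult)
    also have "\<dots> = (\<Sum>w\<in>UNIV. s $ u / s $ v * (P $ u $ w * (\<pi> $ v * P $ v $ w / \<pi> $ w)))"
      using s_nz[of v] by (intro sum.cong refl) (simp add: s_mult[of v, symmetric] field_simps)
    also have "\<dots> = s $ u / s $ v * (conductance $ u $ v / \<pi> $ u)"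
      unfolding sum_distrib_left[symmetric] normal_entries[OF assms] ..
    also have "\<dots> = K $ u $ v"
      using s_nz[of u] by (simp add: K_entry s_mult[of u, symmetric] field_simps)
    finally show ?thesis .
  qed
  then show ?thesis by (simp add: vec_eq_iff K_def)
qed

text \<open>
  Only the in-neighbours of \<open>u\<close>, including \<open>u\<close> itself, contribute to the
  sum that defines the conductance.
\<close>

lemma conductance_le:
  "conductance $ u $ v \<le>
    max_entry \<pi> * (max_nonzero_entry P)\<^sup>2 * (real (max_in_degree (dir_graph P)) + 1)"
proof -
  let ?N = "{w. P $ w $ u \<noteq> 0}" and ?c = "max_entry \<pi> * (max_nonzero_entry P)\<^sup>2"
  have "conductance $ u $ v = (\<Sum>w\<in>?N. \<pi> $ w * (P $ w $ u * P $ w $ v))"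
    by (simp add: conductance_def mult.assoc) (rule sum.mono_neutral_right, auto)
  also have "\<dots> \<le> (\<Sum>w\<in>?N. ?c)"
  proof (rule sum_mono)
    fix w assume w: "w \<in> ?N"
    have le: "P $ w $ x \<le> max_nonzero_entry P" for x
      using max_nonzero_entry_ge[of P w x] max_nonzero_entry_pos by (cases "P $ w $ x = 0") auto
    have "\<pi> $ w * (P $ w $ u * P $ w $ v) \<le>
        max_entry \<pi> * (max_nonzero_entry P * max_nonzero_entry P)"
      using le max_entry_ge max_entry_pos max_nonzero_entry_pos nonneg pos
      by (intro mult_mono mult_nonneg_nonneg) (auto simp: less_imp_le)
    then show "\<pi> $ w * (P $ w $ u * P $ w $ v) \<le> ?c" by (simp add: power2_eq_square)
  qed
  also have "\<dots> = ?c * real (card ?N)" by simp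
  also have "card ?N \<le> max_in_degree (dir_graph P) + 1"
  proof -
    have "card ?N \<le> card (insert u {w. w \<noteq> u \<and> (w, u) \<in> dir_graph P})"
      by (rule card_mono) (auto simp: dir_graph_def)
    also have "\<dots> \<le> Suc (card {w. w \<noteq> u \<and> (w, u) \<in> dir_graph P})" by (rule card_insert_le_m1) auto
    finally show ?thesis using max_in_degree_ge[of u "dir_graph P"] by simp
  qed
  then have "?c * real (card ?N) \<le> ?c * (real (max_in_degree (dir_graph P)) + 1)"
    using max_entry_pos max_nonzero_entry_pos by (intro mult_left_mono) auto
  finally show ?thesis .
qed

text \<open>
  By normality, every pair with positive conductance has a common out-neighbour \<open>w\<close>.
  If \<open>w\<close> is one of the two, the pair is an edge of the graph; otherwise it is joined
  by the path through \<open>w\<close>, and both ends lie among the at most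
  \<open>\<delta>\<close> in-neighbours of \<open>w\<close>. Hence the sum over such pairs is at
  most \<open>1 + 4 (\<delta> - 1) \<le> 4 \<delta> - 2\<close> times the energy of the graph, and
  \<open>(4 \<delta> - 2) (\<delta> + 1)\<close> is \<open>f_in \<delta>\<close>, the factor
  \<open>\<delta> + 1\<close> being the one in the bound on a single conductance. Using
  out-neighbours for the paths, although conductances are defined by in-neighbours, is what makes
  a bound in terms of indegrees alone possible.
\<close>

lemma energy_le:
  assumes normal: "P ** time_reversal P = time_reversal P ** P"
    and \<delta>: "\<delta> = max_in_degree (dir_graph P)" "1 \<le> \<delta>"
  shows "f \<bullet> (laplacian conductance *v f) \<le>
    max_entry \<pi> * (max_nonzero_entry P)\<^sup>2 * f_in \<delta> * (f \<bullet> (graph_laplacian *v f))"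
proof -
  define C where "C = max_entry \<pi> * (max_nonzero_entry P)\<^sup>2 * (real \<delta> + 1)"
  have C0: "0 \<le> C" using max_entry_pos by (simp add: C_def)
  let ?a = "\<lambda>u v. adjacency (undir_graph P) $ u $ v"
  let ?q = "\<lambda>u v. (f $ u - f $ v)\<^sup>2"
  define N where "N w = {u. u \<noteq> w \<and> (u, w) \<in> dir_graph P}" for w
  have linked: "\<exists>w. P $ u $ w \<noteq> 0 \<and> P $ v $ w \<noteq> 0" if "conductance $ u $ v \<noteq> 0" for u v
  proof -
    have "(\<Sum>w\<in>UNIV. P $ u $ w * (\<pi> $ v * P $ v $ w / \<pi> $ w)) \<noteq> 0"
      using normal_entries[OF normal, of u v] that pos[of u] by simp
    then obtain w where "P $ u $ w * (\<pi> $ v * P $ v $ w / \<pi> $ w) \<noteq> 0"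
      by (meson sum.neutral)
    then show ?thesis by auto
  qed
  have pair: "conductance $ u $ v * ?q u v \<le>
      C * (?a u v * ?q u v + (\<Sum>w\<in>UNIV. if u \<in> N w \<and> v \<in> N w then ?q u v else 0))" for u v
  proof (cases "conductance $ u $ v = 0 \<or> u = v")
    case False
    let ?S = "\<Sum>w\<in>UNIV. if u \<in> N w \<and> v \<in> N w then ?q u v else 0"
    have S0: "0 \<le> ?S" by (intro sum_nonneg) auto
    obtain w where w: "P $ u $ w \<noteq> 0" "P $ v $ w \<noteq> 0" using linked False by blast
    have "?q u v \<le> ?a u v * ?q u v + ?S"
    proof (cases "w = u \<or> w = v")
      case True
      then have "?a u v = 1" using w by (auto simp: adjacency_undir_graph)
      then show ?thesis using S0 by simp
    next
      case False
      then have "u \<in> N w \<and> v \<in> N w" using w by (auto simp: N_def dir_graph_def)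
      then have "?q u v \<le> ?S"
        using member_le_sum[of w UNIV "\<lambda>w. if u \<in> N w \<and> v \<in> N w then ?q u v else 0"] by auto
      then show ?thesis using S0 by (simp add: adjacency_undir_graph)
    qed
    moreover have "conductance $ u $ v \<le> C"
      using conductance_le[of u v] by (simp add: C_def \<delta>)
    ultimately show ?thesis using C0 by (intro mult_mono) auto
  qed (use C0 in \<open>auto intro!: mult_nonneg_nonneg sum_nonneg add_nonneg_nonneg simp: adjacency_undir_graph\<close>)
  define T where "T = (\<Sum>u\<in>UNIV. \<Sum>v\<in>UNIV. ?a u v * ?q u v)"
  have T0: "0 \<le> T" unfolding T_def by (intro sum_nonneg) (simp add: adjacency_undir_graph)
  have "(\<Sum>u\<in>UNIV. \<Sum>v\<in>UNIV. \<Sum>w\<in>UNIV. if u \<in> N w \<and> v \<in> N w then ?q u v else 0)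
      = (\<Sum>u\<in>UNIV. \<Sum>w\<in>UNIV. \<Sum>v\<in>UNIV. if u \<in> N w \<and> v \<in> N w then ?q u v else 0)"
    by (rule sum.cong[OF refl], rule sum.swap)
  also have "\<dots> = (\<Sum>w\<in>UNIV. \<Sum>u\<in>UNIV. \<Sum>v\<in>UNIV. if u \<in> N w \<and> v \<in> N w then ?q u v else 0)"
    by (rule sum.swap)
  also have "\<dots> = (\<Sum>w\<in>UNIV. \<Sum>u\<in>N w. \<Sum>v\<in>N w. ?q u v)"
  proof (rule sum.cong[OF refl])
    fix w
    have "(\<Sum>u\<in>UNIV. \<Sum>v\<in>UNIV. if u \<in> N w \<and> v \<in> N w then ?q u v else 0) =
        (\<Sum>u\<in>UNIV. if u \<in> N w then \<Sum>v\<in>UNIV. if v \<in> N w then ?q u v else 0 else 0)"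
      by (rule sum.cong[OF refl]) simp
    then show "(\<Sum>u\<in>UNIV. \<Sum>v\<in>UNIV. if u \<in> N w \<and> v \<in> N w then ?q u v else 0) =
        (\<Sum>u\<in>N w. \<Sum>v\<in>N w. ?q u v)"
      by (simp flip: sum.inter_restrict)
  qed
  also have "\<dots> \<le> (\<Sum>w\<in>UNIV. 4 * (real (card (N w)) - 1) * (\<Sum>u\<in>N w. ?q u w))"
    by (intro sum_mono sum_pairs_le_star) simp
  also have "\<dots> \<le> (\<Sum>w\<in>UNIV. 4 * (real \<delta> - 1) * (\<Sum>u\<in>N w. ?q u w))"
    using max_in_degree_ge[of _ "dir_graph P"]
    by (intro sum_mono mult_right_mono sum_nonneg) (auto simp: N_def \<delta>)
  also have "\<dots> = 4 * (real \<delta> - 1) * (\<Sum>w\<in>UNIV. \<Sum>u\<in>N w. ?q u w)"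
    by (simp add: sum_distrib_left)
  also have "\<dots> \<le> 4 * (real \<delta> - 1) * T"
  proof (rule mult_left_mono)
    have "(\<Sum>w\<in>UNIV. \<Sum>u\<in>N w. ?q u w) = (\<Sum>w\<in>UNIV. \<Sum>u\<in>N w. ?a u w * ?q u w)"
      by (intro sum.cong refl) (auto simp: N_def dir_graph_def adjacency_undir_graph)
    also have "\<dots> \<le> (\<Sum>w\<in>UNIV. \<Sum>u\<in>UNIV. ?a u w * ?q u w)"
      by (intro sum_mono sum_mono2) (auto simp: adjacency_undir_graph)
    also have "\<dots> = T" unfolding T_def by (rule sum.swap)
    finally show "(\<Sum>w\<in>UNIV. \<Sum>u\<in>N w. ?q u w) \<le> T" .
  qed (use \<delta> in simp)
  finally have two_step: "(\<Sum>u\<in>UNIV. \<Sum>v\<in>UNIV. \<Sum>w\<in>UNIV. if u \<in> N w \<and> v \<in> N w then ?q u v else 0)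
    \<le> 4 * (real \<delta> - 1) * T" .
  have "(\<Sum>u\<in>UNIV. \<Sum>v\<in>UNIV. conductance $ u $ v * ?q u v) \<le> (\<Sum>u\<in>UNIV. \<Sum>v\<in>UNIV.
      C * (?a u v * ?q u v + (\<Sum>w\<in>UNIV. if u \<in> N w \<and> v \<in> N w then ?q u v else 0)))"
    by (intro sum_mono pair)
  also have "\<dots> = C * (T + (\<Sum>u\<in>UNIV. \<Sum>v\<in>UNIV. \<Sum>w\<in>UNIV. if u \<in> N w \<and> v \<in> N w then ?q u v else 0))"
    by (simp only: T_def sum.distrib sum_distrib_left[symmetric])
  also have "\<dots> \<le> C * (T + 4 * (real \<delta> - 1) * T)"
    using two_step C0 by (intro mult_left_mono add_left_mono) auto
  also have "\<dots> \<le> C * ((4 * real \<delta> - 2) * T)"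
    using T0 C0 by (intro mult_left_mono) (auto simp: algebra_simps)
  also have "\<dots> = max_entry \<pi> * (max_nonzero_entry P)\<^sup>2 * f_in \<delta> * T"
    by (simp add: C_def f_in_def power2_eq_square algebra_simps)
  finally show ?thesis
    by (simp add: laplacian_form conductance_sym transpose_adjacency T_def)
qed

end

section \<open>The costs as series of Frobenius norms\<close>

lemma trace_sums:
  fixes B :: "nat \<Rightarrow> real ^ 'n ^ 'n"
  assumes "summable B" shows "trace (\<Sum>t. B t) = (\<Sum>t. trace (B t))"
proof -
  have "linear (trace :: real ^ 'n ^ 'n \<Rightarrow> real)"
    by (intro linearI) (simp_all add: trace_def sum.distrib sum_distrib_left)
  then have "bounded_linear (trace :: real ^ 'n ^ 'n \<Rightarrow> real)"
    by (simp add: linear_conv_bounded_linear)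
  then show ?thesis using bounded_linear.suminf assms by metis
qed

lemma norm_matrix_le_entries: "norm (M :: real ^ 'n ^ 'n) \<le> (\<Sum>i\<in>UNIV. \<Sum>j\<in>UNIV. \<bar>M $ i $ j\<bar>)"
proof -
  have "norm M \<le> (\<Sum>i\<in>UNIV. norm (M $ i))" by (simp add: norm_vec_def L2_set_le_sum)
  also have "\<dots> \<le> (\<Sum>i\<in>UNIV. \<Sum>j\<in>UNIV. \<bar>M $ i $ j\<bar>)" by (intro sum_mono norm_le_l1_cart)
  finally show ?thesis .
qed

context consensus_chain
begin

lemma power_A_entry: "mat_power A t $ u $ v = s $ u * mat_power P t $ u $ v / s $ v"
proof (induction t arbitrary: u v)
  case 0
  then show ?case using s_nz by (simp add: mat_def)
next
  case (Suc t)
  have "mat_power A (Suc t) $ u $ v =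
      (\<Sum>w\<in>UNIV. (s $ u * P $ u $ w / s $ w) * (s $ w * mat_power P t $ w $ v / s $ v))"
    by (simp add: matrix_matrix_mult_def Suc) (simp add: A_def)
  also have "\<dots> = (\<Sum>w\<in>UNIV. s $ u * (P $ u $ w * mat_power P t $ w $ v) / s $ v)"
    by (intro sum.cong refl) (simp add: s_nz)
  finally show ?case
    by (simp add: matrix_matrix_mult_def sum_distrib_left sum_divide_distrib)
qed

definition deviation :: "nat \<Rightarrow> real ^ 'n ^ 'n" where
  "deviation t = mat_power P t - outer 1 \<pi>"

definition weighted_norm :: "nat \<Rightarrow> real" where
  "weighted_norm t = (\<Sum>u\<in>UNIV. \<Sum>v\<in>UNIV. \<pi> $ u * (deviation t $ u $ v)\<^sup>2)"

lemma weighted_norm_nonneg: "0 \<le> weighted_norm t"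
  unfolding weighted_norm_def by (intro sum_nonneg) (simp add: less_imp_le[OF pos])

abbreviation "symmetrized_norm t \<equiv> trace (mat_power A t ** transpose (mat_power A t)) - 1"

lemma symmetrized_norm_eq:
  "symmetrized_norm t = (\<Sum>u\<in>UNIV. \<Sum>v\<in>UNIV. \<pi> $ u * (deviation t $ u $ v)\<^sup>2 / \<pi> $ v)"
proof -
  have "symmetrized_norm t = trace ((mat_power A t - outer s s) ** transpose (mat_power A t - outer s s))"
    by (rule trace_deviation[symmetric])
      (simp_all only: mat_power_fixed A_s AT_s norm_s transpose_mat_power)
  also have "\<dots> = (\<Sum>u\<in>UNIV. \<Sum>v\<in>UNIV. ((mat_power A t - outer s s) $ u $ v)\<^sup>2)"
    by (rule trace_mult_transpose)
  also have "\<dots> = (\<Sum>u\<in>UNIV. \<Sum>v\<in>UNIV. \<pi> $ u * (deviation t $ u $ v)\<^sup>2 / \<pi> $ v)"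
  proof (intro sum.cong refl)
    fix u v
    have "(mat_power A t - outer s s) $ u $ v = s $ u * deviation t $ u $ v / s $ v"
      using s_nz[of v]
      by (simp add: power_A_entry outer_def deviation_def s_mult[symmetric] field_simps)
    then show "((mat_power A t - outer s s) $ u $ v)\<^sup>2 = \<pi> $ u * (deviation t $ u $ v)\<^sup>2 / \<pi> $ v"
      by (simp add: s_mult[symmetric] power2_eq_square mult_ac)
  qed
  finally show ?thesis .
qed

text \<open>
  The cost differs from the squared Frobenius norm in the orthonormal basis by the factor
  \<open>\<pi>\<^sub>v\<close> of each column.
\<close>

lemma weighted_norm_bounds:
  "min_entry \<pi> * symmetrized_norm t \<le> weighted_norm t"
  "weighted_norm t \<le> max_entry \<pi> * symmetrized_norm t"
proof -
  have "min_entry \<pi> * (\<pi> $ u * (deviation t $ u $ v)\<^sup>2 / \<pi> $ v) \<le> \<pi> $ u * (deviation t $ u $ v)\<^sup>2" for u v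
    using mult_right_mono[OF min_entry_le[of \<pi> v], of "\<pi> $ u * (deviation t $ u $ v)\<^sup>2"] pos[of u] pos[of v]
    by (simp add: pos_divide_le_eq mult_ac)
  then show "min_entry \<pi> * symmetrized_norm t \<le> weighted_norm t"
    unfolding symmetrized_norm_eq weighted_norm_def sum_distrib_left by (intro sum_mono)
  have "\<pi> $ u * (deviation t $ u $ v)\<^sup>2 \<le> max_entry \<pi> * (\<pi> $ u * (deviation t $ u $ v)\<^sup>2 / \<pi> $ v)" for u v
    using mult_right_mono[OF max_entry_ge[of \<pi> v], of "\<pi> $ u * (deviation t $ u $ v)\<^sup>2"] pos[of u] pos[of v]
    by (simp add: pos_le_divide_eq mult_ac)
  then show "weighted_norm t \<le> max_entry \<pi> * symmetrized_norm t"
    unfolding symmetrized_norm_eq weighted_norm_def sum_distrib_left by (intro sum_mono)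
qed

lemma symmetrized_norm_nonneg: "0 \<le> symmetrized_norm t"
  unfolding symmetrized_norm_eq
  by (intro sum_nonneg divide_nonneg_nonneg mult_nonneg_nonneg) (auto simp: less_imp_le[OF pos])

lemma symmetrized_norm_le: "symmetrized_norm t \<le> trace (mat_power K t) - 1"
  using trace_power_le[of A t] by (simp add: K_def)

lemma trace_power_K_sums:
  assumes "is_green (mat 1 - K) s G"
  shows "(\<lambda>t. trace (mat_power K t) - 1) sums trace G"
proof (rule trace_power_sums[OF K_sym K_s assms])
  show "1 \<le> trace (mat_power K t)" for t
    using symmetrized_norm_nonneg[of t] symmetrized_norm_le[of t] by simp
qed

lemma summable_weighted_norm: "summable weighted_norm"
proof -
  obtain G where "is_green (mat 1 - K) s G" by (rule chain_green)
  then have "summable (\<lambda>t. max_entry \<pi> * (trace (mat_power K t) - 1))"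
    using trace_power_K_sums by (intro summable_mult sums_summable)
  then show ?thesis
  proof (rule summable_comparison_test'[where N = 0])
    fix t
    have "weighted_norm t \<le> max_entry \<pi> * symmetrized_norm t" by (rule weighted_norm_bounds)
    also have "\<dots> \<le> max_entry \<pi> * (trace (mat_power K t) - 1)"
      using symmetrized_norm_le max_entry_pos by (intro mult_left_mono) auto
    finally show "norm (weighted_norm t) \<le> max_entry \<pi> * (trace (mat_power K t) - 1)"
      using weighted_norm_nonneg by simp
  qed
qed

text \<open>
  The trace may be taken inside the series of matrices once that series is known to converge, and
  it does because each entry of the positive semidefinite summand is at most its trace in absolute
  value.
\<close>

lemma weighted_LQ_cost_eq: "weighted_LQ_cost P = (\<Sum>t. weighted_norm t)"
proof -
  define B where "B t = transpose (deviation t) ** diag \<pi> ** deviation t" for t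
  have P1: "P *v 1 = 1" using consensus by (simp add: consensus_matrix_def)
  have dev: "mat_power P t ** (mat 1 - outer 1 \<pi>) = deviation t" for t
    by (simp add: deviation_def matrix_mult_diff matrix_mult_outer mat_power_fixed P1)
  have "transpose (mat 1 - outer 1 \<pi>) = mat 1 - outer \<pi> 1"
    by (simp add: vec_eq_iff transpose_def outer_def mat_def)
  then have devT: "(mat 1 - outer \<pi> 1) ** mat_power (transpose P) t = transpose (deviation t)" for t
    by (metis dev matrix_transpose_mul transpose_mat_power)
  have B: "(mat 1 - outer \<pi> 1) ** mat_power (transpose P) t ** diag \<pi>
                   ** mat_power P t ** (mat 1 - outer 1 \<pi>) = B t" for t
    unfolding B_def devT by (simp only: dev matrix_mul_assoc[symmetric])
  have entry: "B t $ i $ j = (\<Sum>u\<in>UNIV. \<pi> $ u * (deviation t $ u $ i * deviation t $ u $ j))" for t i j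
  proof -
    have "B t $ i $ j = (\<Sum>u\<in>UNIV. (transpose (deviation t) ** diag \<pi>) $ i $ u * deviation t $ u $ j)"
      unfolding B_def by (subst matrix_matrix_mult_def) simp
    then show ?thesis by (simp add: mult_diag transpose_def mult_ac)
  qed
  have tr: "trace (B t) = weighted_norm t" for t
    unfolding trace_def entry weighted_norm_def
    by (subst sum.swap) (simp add: power2_eq_square)
  have bound: "\<bar>B t $ i $ j\<bar> \<le> weighted_norm t" for t i j
  proof -
    let ?d = "\<lambda>u i. \<bar>deviation t $ u $ i\<bar>"
    have col: "(\<Sum>u\<in>UNIV. \<pi> $ u * (deviation t $ u $ k)\<^sup>2) \<le> weighted_norm t" for k
      unfolding weighted_norm_def
      by (intro sum_mono member_le_sum) (auto simp: less_imp_le[OF pos])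
    have "2 * \<bar>B t $ i $ j\<bar> \<le> 2 * (\<Sum>u\<in>UNIV. \<pi> $ u * (?d u i * ?d u j))"
      unfolding entry using pos
      by (simp, intro order_trans[OF sum_abs] sum_mono) (simp add: abs_mult less_imp_le)
    also have "\<dots> \<le> (\<Sum>u\<in>UNIV. \<pi> $ u * ((deviation t $ u $ i)\<^sup>2 + (deviation t $ u $ j)\<^sup>2))"
      unfolding sum_distrib_left
    proof (rule sum_mono)
      fix u
      have "0 \<le> (?d u i - ?d u j)\<^sup>2" by simp
      then have "2 * (?d u i * ?d u j) \<le> (deviation t $ u $ i)\<^sup>2 + (deviation t $ u $ j)\<^sup>2"
        by (simp add: power2_diff)
      then show "2 * (\<pi> $ u * (?d u i * ?d u j)) \<le> \<pi> $ u * ((deviation t $ u $ i)\<^sup>2 + (deviation t $ u $ j)\<^sup>2)"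
        using mult_left_mono[OF _ less_imp_le[OF pos[of u]]] by fastforce
    qed
    also have "\<dots> \<le> 2 * weighted_norm t"
      using col[of i] col[of j] by (simp add: distrib_left sum.distrib)
    finally show ?thesis by simp
  qed
  have "summable B"
  proof (rule summable_comparison_test'[where N = 0])
    show "summable (\<lambda>t. (real CARD('n))\<^sup>2 * weighted_norm t)"
      by (intro summable_mult summable_weighted_norm)
    fix t
    have "norm (B t) \<le> (\<Sum>i\<in>(UNIV :: 'n set). \<Sum>j\<in>(UNIV :: 'n set). weighted_norm t)"
      by (intro order_trans[OF norm_matrix_le_entries] sum_mono bound)
    then show "norm (B t) \<le> (real CARD('n))\<^sup>2 * weighted_norm t"
      by (simp add: power2_eq_square mult.assoc)
  qed
  then show ?thesis
    by (simp add: weighted_LQ_cost_def invariant_measure_eq B trace_sums tr)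
qed

lemma LQ_cost_bounds:
  "real CARD('n) * min_entry \<pi> * LQ_cost P \<le> weighted_LQ_cost P"
  "weighted_LQ_cost P \<le> real CARD('n) * max_entry \<pi> * LQ_cost P"
proof -
  define U where "U t = (frobenius_norm (deviation t))\<^sup>2" for t
  have U: "U t = (\<Sum>u\<in>UNIV. \<Sum>v\<in>UNIV. (deviation t $ u $ v)\<^sup>2)" for t
    by (simp add: U_def frobenius_norm_def sum_nonneg)
  have lo: "min_entry \<pi> * U t \<le> weighted_norm t" for t
    unfolding U weighted_norm_def sum_distrib_left
    by (intro sum_mono mult_right_mono min_entry_le) simp
  have hi: "weighted_norm t \<le> max_entry \<pi> * U t" for t
    unfolding U weighted_norm_def sum_distrib_left
    by (intro sum_mono mult_right_mono max_entry_ge) simp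
  have "summable U"
  proof (rule summable_comparison_test'[where N = 0])
    show "summable (\<lambda>t. weighted_norm t / min_entry \<pi>)"
      by (intro summable_divide summable_weighted_norm)
    show "norm (U t) \<le> weighted_norm t / min_entry \<pi>" for t
      using lo[of t] min_entry_pos by (simp add: U_def pos_le_divide_eq mult.commute)
  qed
  moreover have "LQ_cost P = 1 / real CARD('n) * (\<Sum>t. U t)"
    by (simp add: LQ_cost_def invariant_measure_eq U_def deviation_def)
  then have "real CARD('n) * LQ_cost P = (\<Sum>t. U t)" by simp
  ultimately have "real CARD('n) * min_entry \<pi> * LQ_cost P = (\<Sum>t. min_entry \<pi> * U t)"
    "real CARD('n) * max_entry \<pi> * LQ_cost P = (\<Sum>t. max_entry \<pi> * U t)"
    by (simp_all add: suminf_mult mult_ac)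
  then show "real CARD('n) * min_entry \<pi> * LQ_cost P \<le> weighted_LQ_cost P"
    "weighted_LQ_cost P \<le> real CARD('n) * max_entry \<pi> * LQ_cost P"
    unfolding weighted_LQ_cost_eq using \<open>summable U\<close>
    by (auto intro!: suminf_le lo hi summable_mult summable_weighted_norm)
qed

end

section \<open>Comparison of the costs with the average effective resistance\<close>

context consensus_chain
begin

abbreviation "resistance \<equiv> avg_eff_resistance (undir_graph P)"

lemma resistance_nonneg: "0 \<le> resistance"
proof -
  obtain G where G: "is_green graph_laplacian ((1 / sqrt (real CARD('n))) *\<^sub>R 1) G"
    by (rule graph_green)
  have "0 \<le> trace G"
    using green_psd[OF G] by (auto simp: trace_def diag_entry_inner intro!: sum_nonneg)
  then show ?thesis by (simp add: avg_eff_resistance_green[OF G])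
qed

text \<open>
  Term by term, \<open>J\<^sub>w\<close> is at most
  \<open>\<pi>\<^sub>m\<^sub>a\<^sub>x (tr K\<^sup>t - 1)\<close>, whose series is
  \<open>\<pi>\<^sub>m\<^sub>a\<^sub>x\<close> times the trace of the inverse of
  \<open>I - K\<close>. The change of variables by \<open>s\<close> to the unit-conductance graph
  contributes the second factor \<open>\<pi>\<^sub>m\<^sub>a\<^sub>x\<close>.
\<close>

lemma weighted_upper:
  "min_entry \<pi> * (min_nonzero_entry P)\<^sup>2 * weighted_LQ_cost P \<le>
    (max_entry \<pi>)\<^sup>2 * real CARD('n) * resistance"
proof -
  let ?r = "1 / sqrt (real CARD('n))" and ?\<kappa> = "min_entry \<pi> * (min_nonzero_entry P)\<^sup>2"
  obtain G where G: "is_green (mat 1 - K) s G" by (rule chain_green)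
  obtain R where R: "is_green graph_laplacian (?r *\<^sub>R 1) R" by (rule graph_green)
  have \<kappa>: "0 < ?\<kappa>" using min_entry_pos min_nonzero_entry_pos by simp
  have "weighted_LQ_cost P \<le> (\<Sum>t. max_entry \<pi> * (trace (mat_power K t) - 1))"
    unfolding weighted_LQ_cost_eq
  proof (rule suminf_le)
    show "summable (\<lambda>t. max_entry \<pi> * (trace (mat_power K t) - 1))"
      using trace_power_K_sums[OF G] by (intro summable_mult sums_summable)
    show "weighted_norm t \<le> max_entry \<pi> * (trace (mat_power K t) - 1)" for t
      using weighted_norm_bounds(2) symmetrized_norm_le max_entry_pos
      by (meson less_imp_le mult_left_mono order_trans)
  qed (rule summable_weighted_norm)
  also have "\<dots> = max_entry \<pi> * trace G"
    using trace_power_K_sums[OF G] by (simp add: sums_iff suminf_mult)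
  finally have "?\<kappa> * weighted_LQ_cost P \<le> ?\<kappa> * (max_entry \<pi> * trace G)"
    using \<kappa> by (intro mult_left_mono) auto
  also have "\<dots> = max_entry \<pi> * (?\<kappa> * trace G)" by simp
  also have "\<dots> \<le> max_entry \<pi> * (max_entry \<pi> * trace R)"
  proof (rule mult_left_mono[OF green_trace_mono[OF G R]])
    show "s $ u \<noteq> 0" "(s $ u)\<^sup>2 \<le> max_entry \<pi>" for u
      using s_nz[of u] max_entry_ge[of \<pi> u] by (simp_all add: power2_eq_square s_mult)
    show "diag s *v (?r *\<^sub>R 1) = ?r *\<^sub>R s" by (simp add: diag_vector vec_eq_iff)
    show "?\<kappa> * (f \<bullet> (graph_laplacian *v f)) \<le> (diag s *v f) \<bullet> ((mat 1 - K) *v (diag s *v f))" for f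
      unfolding one_minus_K_form by (rule energy_ge)
  qed (use \<kappa> max_entry_pos in auto)
  finally show ?thesis by (simp add: avg_eff_resistance_green[OF R] power2_eq_square)
qed

text \<open>
  For normal \<open>A\<close> the estimate of the powers of \<open>A\<close> by those of
  \<open>A\<^sup>T A\<close> is an equality, so the chain of estimates for the upper bound can be
  run backwards, with the change of variables inverted.
\<close>

lemma weighted_lower:
  assumes normal: "P ** time_reversal P = time_reversal P ** P"
    and \<delta>: "\<delta> = max_in_degree (dir_graph P)" "1 \<le> \<delta>"
  shows "(min_entry \<pi>)\<^sup>2 * real CARD('n) * resistance \<le>
    max_entry \<pi> * (max_nonzero_entry P)\<^sup>2 * f_in \<delta> * weighted_LQ_cost P"
proof -
  let ?r = "1 / sqrt (real CARD('n))" and ?c = "max_entry \<pi> * (max_nonzero_entry P)\<^sup>2 * f_in \<delta>"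
  obtain G where G: "is_green (mat 1 - K) s G" by (rule chain_green)
  obtain R where R: "is_green graph_laplacian (?r *\<^sub>R 1) R" by (rule graph_green)
  define d :: "real ^ 'n" where "d = (\<chi> u. 1 / s $ u)"
  have "0 < f_in \<delta>"
  proof -
    have "1 * 1 \<le> real \<delta> * real \<delta>" using \<delta> by (intro mult_mono) auto
    then show ?thesis using \<delta> by (simp add: f_in_def power2_eq_square)
  qed
  then have c: "0 < ?c" using max_entry_pos max_nonzero_entry_pos by simp
  have "1 / ?c * trace R \<le> 1 / min_entry \<pi> * trace G"
  proof (rule green_trace_mono[OF R G])
    show "d $ u \<noteq> 0" for u using s_nz[of u] by (simp add: d_def)
    show "(d $ u)\<^sup>2 \<le> 1 / min_entry \<pi>" for u
      using min_entry_le[of \<pi> u] min_entry_pos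
      by (simp add: d_def power2_eq_square s_mult frac_le)
    show "diag d *v s = sqrt (real CARD('n)) *\<^sub>R (?r *\<^sub>R 1)"
      using s_nz by (simp add: d_def diag_vector vec_eq_iff)
    fix f :: "real ^ 'n"
    have "f = diag s *v (diag d *v f)" using s_nz by (simp add: d_def diag_vector vec_eq_iff)
    then have "f \<bullet> ((mat 1 - K) *v f) \<le> ?c * ((diag d *v f) \<bullet> (graph_laplacian *v (diag d *v f)))"
      using energy_le[OF normal \<delta>, of "diag d *v f"] one_minus_K_form[of "diag d *v f"] by simp
    then show "1 / ?c * (f \<bullet> ((mat 1 - K) *v f)) \<le> (diag d *v f) \<bullet> (graph_laplacian *v (diag d *v f))"
      using c by (simp add: pos_divide_le_eq mult.commute)
  qed (use c in auto)
  then have "min_entry \<pi> * trace R \<le> ?c * trace G"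
    using c min_entry_pos by (simp add: field_simps)
  then have "min_entry \<pi> * (min_entry \<pi> * trace R) \<le> min_entry \<pi> * (?c * trace G)"
    using min_entry_pos by (intro mult_left_mono) auto
  also have "\<dots> = ?c * (\<Sum>t. min_entry \<pi> * (trace (mat_power K t) - 1))"
    using trace_power_K_sums[OF G] by (simp add: sums_iff suminf_mult)
  also have "\<dots> \<le> ?c * weighted_LQ_cost P"
    unfolding weighted_LQ_cost_eq
  proof (intro mult_left_mono suminf_le)
    show "summable (\<lambda>t. min_entry \<pi> * (trace (mat_power K t) - 1))"
      using trace_power_K_sums[OF G] by (intro summable_mult sums_summable)
    show "min_entry \<pi> * (trace (mat_power K t) - 1) \<le> weighted_norm t" for t
      using weighted_norm_bounds(1)[of t] trace_power_normal[OF normal_A[OF normal], of t]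
      by (simp add: K_def)
  qed (use c summable_weighted_norm in auto)
  finally show ?thesis by (simp add: avg_eff_resistance_green[OF R] power2_eq_square)
qed

end

theorem theorem3p6:
  fixes P :: "real ^ 'n ^ 'n" and \<pi> :: "real ^ 'n"
    and n \<pi>_min \<pi>_max p_min p_max :: real and \<delta>_in :: nat
  assumes "consensus_matrix P"
    and "n = real CARD('n)"
    and "\<pi> = invariant_measure P"
    and "\<pi>_min = min_entry \<pi>" and "\<pi>_max = max_entry \<pi>"
    and "p_min = min_nonzero_entry P" and "p_max = max_nonzero_entry P"
    and "\<delta>_in = max_in_degree (dir_graph P)"
  shows "LQ_cost P \<le>
           \<pi>_max ^ 3 * n / (p_min\<^sup>2 * \<pi>_min\<^sup>2) * avg_eff_resistance (undir_graph P) \<and>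
         weighted_LQ_cost P \<le>
           \<pi>_max ^ 3 * n\<^sup>2 / (p_min\<^sup>2 * \<pi>_min) * avg_eff_resistance (undir_graph P) \<and>
         (P ** time_reversal P = time_reversal P ** P \<longrightarrow>
           LQ_cost P \<ge>
             \<pi>_min ^ 3 * n / (p_max\<^sup>2 * f_in \<delta>_in * \<pi>_max\<^sup>2) * avg_eff_resistance (undir_graph P) \<and>
           weighted_LQ_cost P \<ge>
             \<pi>_min ^ 3 * n\<^sup>2 / (p_max\<^sup>2 * f_in \<delta>_in * \<pi>_max) * avg_eff_resistance (undir_graph P))"
proof -
  interpret consensus_chain P \<pi>
    by unfold_locales (use assms invariant_measure[of P] in auto)
  let ?J = "LQ_cost P" and ?Jw = "weighted_LQ_cost P" and ?R = "avg_eff_resistance (undir_graph P)"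
  have n: "0 < n" using assms by simp
  have pos: "0 < \<pi>_min" "0 < \<pi>_max" "0 < p_min" "0 < p_max"
    using assms min_entry_pos max_entry_pos min_nonzero_entry_pos max_nonzero_entry_pos by auto
  have R: "0 \<le> ?R" by (rule resistance_nonneg)
  have Jw: "0 \<le> ?Jw"
    unfolding weighted_LQ_cost_eq by (rule suminf_nonneg[OF summable_weighted_norm weighted_norm_nonneg])
  have J_Jw: "n * \<pi>_min * ?J \<le> ?Jw" and Jw_J: "?Jw \<le> n * \<pi>_max * ?J"
    using LQ_cost_bounds assms by auto
  have up: "?Jw \<le> \<pi>_max ^ 3 * n\<^sup>2 / (p_min\<^sup>2 * \<pi>_min) * ?R"
  proof -
    have "\<pi>_min * p_min\<^sup>2 * ?Jw \<le> \<pi>_max\<^sup>2 * n * ?R" using weighted_upper assms by simp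
    \<comment> \<open>The stated constant is weaker by the factor \<open>n \<pi>_max \<ge> 1\<close>.\<close>
    also have "\<dots> \<le> (n * \<pi>_max) * (\<pi>_max\<^sup>2 * n * ?R)"
      using mult_right_mono[OF card_max_entry, of "\<pi>_max\<^sup>2 * n * ?R"] assms n R by simp
    finally show ?thesis using pos by (simp add: field_simps power2_eq_square power3_eq_cube)
  qed
  moreover have "?J \<le> \<pi>_max ^ 3 * n / (p_min\<^sup>2 * \<pi>_min\<^sup>2) * ?R"
  proof -
    have "?J \<le> ?Jw / (n * \<pi>_min)" using J_Jw n pos by (simp add: pos_le_divide_eq mult.commute)
    also have "\<dots> \<le> (\<pi>_max ^ 3 * n\<^sup>2 / (p_min\<^sup>2 * \<pi>_min) * ?R) / (n * \<pi>_min)"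
      using up n pos by (intro divide_right_mono) auto
    also have "\<dots> = \<pi>_max ^ 3 * n / (p_min\<^sup>2 * \<pi>_min\<^sup>2) * ?R"
      using n pos by (simp add: field_simps power2_eq_square)
    finally show ?thesis .
  qed
  moreover have low: "\<pi>_min ^ 3 * n\<^sup>2 / (p_max\<^sup>2 * f_in \<delta>_in * \<pi>_max) * ?R \<le> ?Jw"
    if normal: "P ** time_reversal P = time_reversal P ** P"
  \<comment> \<open>Without edges between distinct vertices, \<open>f_in\<close> is negative, and the bound only says that the cost is nonnegative.\<close>
  proof (cases "\<delta>_in = 0")
    case True
    then have "\<pi>_min ^ 3 * n\<^sup>2 / (p_max\<^sup>2 * f_in \<delta>_in * \<pi>_max) * ?R \<le> 0"
      using R n pos by (auto simp: f_in_def intro!: mult_nonneg_nonneg)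
    then show ?thesis using Jw by simp
  next
    case False
    then have "1 * 1 \<le> real \<delta>_in * real \<delta>_in" by (intro mult_mono) auto
    then have f: "0 < f_in \<delta>_in" using False by (simp add: f_in_def power2_eq_square)
    \<comment> \<open>Here the stated constant is weaker by the factor \<open>n \<pi>_min \<le> 1\<close>.\<close>
    have "(n * \<pi>_min) * (\<pi>_min\<^sup>2 * n * ?R) \<le> \<pi>_min\<^sup>2 * n * ?R"
      using mult_right_mono[OF card_min_entry, of "\<pi>_min\<^sup>2 * n * ?R"] assms n R by simp
    also have "\<dots> \<le> \<pi>_max * p_max\<^sup>2 * f_in \<delta>_in * ?Jw"
      using weighted_lower[OF normal, of \<delta>_in] False assms by simp
    finally show ?thesis using pos f by (simp add: field_simps power2_eq_square power3_eq_cube)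
  qed
  moreover have "\<pi>_min ^ 3 * n / (p_max\<^sup>2 * f_in \<delta>_in * \<pi>_max\<^sup>2) * ?R \<le> ?J"
    if normal: "P ** time_reversal P = time_reversal P ** P"
  proof -
    have "\<pi>_min ^ 3 * n / (p_max\<^sup>2 * f_in \<delta>_in * \<pi>_max\<^sup>2) * ?R =
        (\<pi>_min ^ 3 * n\<^sup>2 / (p_max\<^sup>2 * f_in \<delta>_in * \<pi>_max) * ?R) / (n * \<pi>_max)"
      using n pos by (simp add: field_simps power2_eq_square)
    also have "\<dots> \<le> ?Jw / (n * \<pi>_max)"
      using low[OF normal] n pos by (intro divide_right_mono) auto
    also have "\<dots> \<le> ?J" using Jw_J n pos by (simp add: pos_divide_le_eq mult.commute)
    finally show ?thesis .
  qed
  ultimately show ?thesis by blast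
qed

end
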